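(* Let $d\ge 1$, let $f:\mathbb{Q}\times\mathbb{Q}^d\to\mathbb{Q}^d$ be the projection onto the second factor, and let $\mathcal{P}\subset\mathbb{Q}\times\mathbb{Q}^d$ be a lattice polytope (with respect to $\mathbb{Z}\times\mathbb{Z}^d$). Suppose that the restriction of $f$ to $\mathcal{P}$ is a lattice segmental fibration and that the polytope $\mathcal{Q}:=f(\mathcal{P})$ is unimodular. Then $\mathcal{P}$ is very ample.
   Context: A lattice polytope is the convex hull of finitely many lattice points. The projection $f$ restricted to a lattice polytope $\mathcal{P}\subset\mathbb{Q}\times\mathbb{Q}^d$ is a lattice segmental fibration if for every lattice point $x\in f(\mathcal{P})\cap\mathbb{Z}^d$ the preimage $f^{-1}(x)\cap\mathcal{P}$ is a lattice segment (a segment whose endpoints are lattice points) of positive length. A lattice polytope is unimodular if all its triangulations (into simplices whose vertices are lattice points) are unimodular, that is, each simplex of the triangulation of full dimension in the polytope has normalized volume $1$ (with respect to the lattice points of the affine span of the polytope). A lattice polytope $\mathcal{P}$ is very ample in a lattice $M$ (here $M=\mathbb{Z}\times\mathbb{Z}^d$) if for every sufficiently large integer $k$ every lattice point in $k\mathcal{P}$ is a sum of $k$ lattice points of $\mathcal{P}$. *)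

theory Defs
  imports "HOL-Analysis.Analysis"
begin

text \<open>
  The library's convexity notions are tied to real vector spaces. The definitions below
  follow the same pattern over the rationals, with the scalar multiplication
  \<open>s\<close> as a parameter, so that they apply both to \<open>rat ^ 'd\<close> (with \<open>(*s)\<close>) and to
  \<open>rat \<times> (rat ^ 'd)\<close> (with \<open>pscale\<close>).
\<close>

definition pscale :: "rat \<Rightarrow> rat \<times> (rat ^ 'd) \<Rightarrow> rat \<times> (rat ^ 'd)" where
  "pscale c p = (c * fst p, c *s snd p)"

lemma vector_space_pscale: "vector_space pscale"
  by unfold_locales
    (auto simp: pscale_def algebra_simps vec.scale_right_distrib vec.scale_left_distrib)

definition rat_convex :: "(rat \<Rightarrow> 'v \<Rightarrow> 'v::ab_group_add) \<Rightarrow> 'v set \<Rightarrow> bool" where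
  "rat_convex s C \<longleftrightarrow>
     (\<forall>x\<in>C. \<forall>y\<in>C. \<forall>u\<ge>0. \<forall>v\<ge>0. u + v = 1 \<longrightarrow> s u x + s v y \<in> C)"

definition rat_affine :: "(rat \<Rightarrow> 'v \<Rightarrow> 'v::ab_group_add) \<Rightarrow> 'v set \<Rightarrow> bool" where
  "rat_affine s A \<longleftrightarrow> (\<forall>x\<in>A. \<forall>y\<in>A. \<forall>u v. u + v = 1 \<longrightarrow> s u x + s v y \<in> A)"

definition int_vecs :: "(rat ^ 'd) set" where
  "int_vecs = {x. \<forall>i. x $ i \<in> \<int>}"

definition prod_lattice :: "(rat \<times> (rat ^ 'd)) set" where
  "prod_lattice = \<int> \<times> int_vecs"

definition lattice_polytope ::
    "(rat \<Rightarrow> 'v \<Rightarrow> 'v::ab_group_add) \<Rightarrow> 'v set \<Rightarrow> 'v set \<Rightarrow> bool" where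
  "lattice_polytope s L P \<longleftrightarrow> (\<exists>S. finite S \<and> S \<subseteq> L \<and> P = rat_convex s hull S)"

definition lattice_segment ::
    "(rat \<Rightarrow> 'v \<Rightarrow> 'v::ab_group_add) \<Rightarrow> 'v set \<Rightarrow> 'v set \<Rightarrow> bool" where
  "lattice_segment s L S \<longleftrightarrow>
     (\<exists>a b. a \<in> L \<and> b \<in> L \<and> a \<noteq> b \<and> S = rat_convex s hull {a, b})"

definition lattice_segmental_fibration ::
    "(rat \<times> (rat ^ 'd) \<Rightarrow> rat ^ 'd) \<Rightarrow> (rat \<times> (rat ^ 'd)) set \<Rightarrow> bool" where
  "lattice_segmental_fibration f P \<longleftrightarrow>
     (\<forall>x \<in> f ` P \<inter> int_vecs. lattice_segment pscale prod_lattice (f -` {x} \<inter> P))"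

definition very_ample ::
    "(rat \<Rightarrow> 'v \<Rightarrow> 'v::ab_group_add) \<Rightarrow> 'v set \<Rightarrow> 'v set \<Rightarrow> bool" where
  "very_ample s L P \<longleftrightarrow>
     (\<forall>\<^sub>F k in sequentially. \<forall>x \<in> s (of_nat k) ` P \<inter> L.
        \<exists>p. (\<forall>i<k. p i \<in> P \<inter> L) \<and> x = (\<Sum>i<k. p i))"

definition rat_aff_indep :: "(rat ^ 'd) set \<Rightarrow> bool" where
  "rat_aff_indep V \<longleftrightarrow> finite V \<and>
     (\<forall>u. sum u V = 0 \<and> (\<Sum>v\<in>V. u v *s v) = 0 \<longrightarrow> (\<forall>v\<in>V. u v = 0))"

definition rat_aff_dim :: "(rat ^ 'd) set \<Rightarrow> nat" where
  "rat_aff_dim S = vec.dim {x - y | x y. x \<in> S \<and> y \<in> S}"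

text \<open>
  A triangulation is given by the vertex sets of its simplices (faces included). The
  simplices meet face to face: the faces of a simplex are the hulls of the nonempty
  subsets of its vertex set, so a common face is spanned by the common vertices.
\<close>

definition lattice_triangulation :: "(rat ^ 'd) set set \<Rightarrow> (rat ^ 'd) set \<Rightarrow> bool" where
  "lattice_triangulation T Q \<longleftrightarrow>
     finite T \<and>
     (\<forall>V\<in>T. V \<noteq> {} \<and> V \<subseteq> int_vecs \<and> rat_aff_indep V) \<and>
     (\<forall>V\<in>T. \<forall>W. W \<subseteq> V \<and> W \<noteq> {} \<longrightarrow> W \<in> T) \<and>
     (\<Union>V\<in>T. rat_convex (*s) hull V) = Q \<and>
     (\<forall>V\<in>T. \<forall>W\<in>T. (rat_convex (*s) hull V) \<inter> (rat_convex (*s) hull W)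
        = rat_convex (*s) hull (V \<inter> W))"

text \<open>The group generated by the differences of the vertices in \<open>V\<close>.\<close>

definition edge_lattice :: "(rat ^ 'd) set \<Rightarrow> (rat ^ 'd) set" where
  "edge_lattice V = {\<Sum>v\<in>V. of_int (c v) *s v | c :: rat ^ 'd \<Rightarrow> int. sum c V = 0}"

text \<open>
  The volume of the simplex with vertex set \<open>V\<close>, normalized with respect to the affine
  lattice \<open>A\<close> of the same dimension \<open>m\<close>: \<open>m!\<close> times the ratio of the volume of the simplex
  to that of a fundamental cell of \<open>A\<close>. As \<open>m!\<close> times the volume of the simplex is the
  volume of a fundamental cell of \<open>edge_lattice V\<close>, this is the index of \<open>edge_lattice V\<close>,
  i.e. the number of its classes in \<open>A\<close>.
\<close>

definition normalized_volume :: "(rat ^ 'd) set \<Rightarrow> (rat ^ 'd) set \<Rightarrow> nat" where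
  "normalized_volume A V =
     card (A // {(x, y). x \<in> A \<and> y \<in> A \<and> x - y \<in> edge_lattice V})"

definition unimodular :: "(rat ^ 'd) set \<Rightarrow> bool" where
  "unimodular Q \<longleftrightarrow>
     (\<forall>T. lattice_triangulation T Q \<longrightarrow>
       (\<forall>V\<in>T. rat_aff_dim (rat_convex (*s) hull V) = rat_aff_dim Q \<longrightarrow>
          normalized_volume ((rat_affine (*s) hull Q) \<inter> int_vecs) V = 1))"

end

theory Submission
  imports Defs "HOL-Library.Multiset"
begin

text \<open>
  Let \<open>A\<close> be the image under \<open>snd\<close> of a finite set of lattice points spanning \<open>P\<close>, so that the base
  \<open>Q = snd ` P\<close> is the hull of \<open>A\<close>. Over each \<open>a \<in> A\<close> the fiber is an integral interval
  \<open>[lo a, hi a]\<close> of length at least one, and every integer in it is the height of a lattice point of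
  \<open>P\<close>. Fix a lattice point \<open>(t, y)\<close> of \<open>k P\<close>. A multiset \<open>M\<close> of \<open>k\<close> points of \<open>A\<close> with sum \<open>y\<close> lifts to
  \<open>k\<close> lattice points of \<open>P\<close> with sum \<open>(s, y)\<close> for every integer \<open>s\<close> between the sums of \<open>lo\<close> and of
  \<open>hi\<close> over \<open>M\<close> (\<open>lift_mset_to_fibers\<close>). It therefore suffices to find an \<open>M\<close> whose interval
  contains \<open>t\<close>.

  \<^bold>\<open>An \<open>M\<close> with lower end at most \<open>t\<close>, and an \<open>N\<close> with upper end at least \<open>t\<close>.\<close> With rational
  weights on \<open>A\<close> both exist because \<open>(t, y)\<close> lies in \<open>k P\<close> (\<open>weights_below_height\<close>). By Caratheodory's
  argument the weights may be moved to an affinely independent set \<open>V\<close> without increasing a given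
  linear cost (\<open>caratheodory_with_cost\<close>). Unimodularity makes the resulting weights integral
  (\<open>unimodular_integral_weights\<close>): a maximal affinely independent subset of \<open>A\<close> containing \<open>V\<close> is a
  full-dimensional simplex of some lattice triangulation of \<open>Q\<close>, so its edges generate all lattice
  directions of the affine span.

  \<^bold>\<open>Every lattice simplex belongs to a triangulation.\<close> The hypothesis speaks about triangulations,
  so one containing a given simplex is needed. It is the placing triangulation
  (\<open>extend_triangulation\<close>): the points of \<open>A\<close> are added one at a time, and a point \<open>p\<close> outside the
  polytope triangulated so far is joined to all faces visible from \<open>p\<close>. That these cones cover
  the new polytope needs, on each ray from \<open>p\<close> meeting the old polytope, a first point of it. Over the
  rationals this is an optimal solution of a linear program, which exists because only the finitely
  many affinely independent supports matter (\<open>barycentric_cost_minimum\<close>).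

  \<^bold>\<open>From \<open>M\<close> to \<open>N\<close>.\<close> Pairs of multisets over \<open>A\<close> with equal size and equal sum form a
  monoid that is generated by finitely many pairs, by Dickson's lemma
  (\<open>finitely_many_minimal_mset_pairs\<close>). Hence \<open>M\<close> is turned into \<open>N\<close> by exchanges from a finite list,
  each of which moves the lower end of the interval up by at most a constant \<open>C\<close>. All
  intervals on the way have length at least \<open>k\<close>, so for \<open>k \<ge> C\<close> they leave no gap, and one of
  them contains \<open>t\<close> (\<open>intermediate_representation\<close>). The same \<open>C\<close> serves all \<open>(t, y)\<close>, which is what
  very ampleness asks for.
\<close>

section \<open>Barycentric weights and rational polytopes\<close>

abbreviation conv :: "(rat ^ 'd) set \<Rightarrow> (rat ^ 'd) set" where
  "conv S \<equiv> rat_convex (*s) hull S"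

definition barycentric :: "(rat ^ 'd \<Rightarrow> rat) \<Rightarrow> (rat ^ 'd) set \<Rightarrow> rat ^ 'd \<Rightarrow> bool" where
  "barycentric w V z \<longleftrightarrow> (\<forall>v\<in>V. 0 \<le> w v) \<and> sum w V = 1 \<and> (\<Sum>v\<in>V. w v *s v) = z"

lemma rat_convex_hull: "rat_convex s (rat_convex s hull S)"
proof -
  have "\<forall>T \<in> F. rat_convex s T \<Longrightarrow> rat_convex s (\<Inter>F)" for F :: "'a set set"
    unfolding rat_convex_def by blast
  then show ?thesis by (simp add: hull_in)
qed

lemma conv_combination:
  assumes "x \<in> conv S" "y \<in> conv S" "0 \<le> u" "u \<le> 1"
  shows "u *s x + (1 - u) *s y \<in> conv S"
proof -
  have "rat_convex (*s) (conv S)" by (rule rat_convex_hull)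
  then have "\<forall>u\<ge>0. \<forall>v\<ge>0. u + v = 1 \<longrightarrow> u *s x + v *s y \<in> conv S"
    using assms(1,2) rat_convex_def[of "(*s)" "conv S"] by blast
  then show ?thesis using assms(3,4) by (metis add_diff_cancel_left' diff_add_cancel diff_ge_0_iff_ge add.commute)
qed

lemma conv_subset_conv: "F \<subseteq> conv A \<Longrightarrow> conv F \<subseteq> conv A"
  by (simp add: hull_minimal rat_convex_hull)

lemma conv_empty: "conv {} = {}"
  using hull_minimal[of "{}" "{}" "rat_convex (*s)"] by (auto simp: rat_convex_def)

lemma conv_subset_barycentric:
  assumes "finite S"
  shows "conv S \<subseteq> {z. \<exists>w. barycentric w S z}"
proof (rule hull_minimal)
  show "S \<subseteq> {z. \<exists>w. barycentric w S z}"
  proof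
    fix v assume v: "v \<in> S"
    have "barycentric (\<lambda>x. if x = v then 1 else 0) S v"
      using assms v by (auto simp: barycentric_def if_distrib[of "\<lambda>c. c *s _"] cong: if_cong)
    then show "v \<in> {z. \<exists>w. barycentric w S z}" by blast
  qed
  show "rat_convex (*s) {z. \<exists>w. barycentric w S z}"
    unfolding rat_convex_def
  proof (intro ballI allI impI)
    fix x y :: "rat ^ 'a" and u v :: rat
    assume "x \<in> {z. \<exists>w. barycentric w S z}" "y \<in> {z. \<exists>w. barycentric w S z}"
      and uv: "0 \<le> u" "0 \<le> v" "u + v = 1"
    then obtain w w' where w: "barycentric w S x" "barycentric w' S y" by blast
    have "barycentric (\<lambda>a. u * w a + v * w' a) S (u *s x + v *s y)"
      using w uv
      by (auto simp: barycentric_def sum.distrib vec.scale_sum_right vec.scale_left_distrib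
          simp flip: sum_distrib_left)
    then show "u *s x + v *s y \<in> {z. \<exists>w. barycentric w S z}" by blast
  qed
qed

lemma barycentric_rescale:
  assumes "\<forall>v\<in>S. 0 \<le> w v" "sum w S = r" "0 < r"
  shows "barycentric (\<lambda>v. w v / r) S (inverse r *s (\<Sum>v\<in>S. w v *s v))"
  using assms unfolding barycentric_def
  by (auto simp: vec.scale_sum_right divide_inverse mult.commute simp flip: sum_distrib_left sum_divide_distrib)

lemma barycentric_imp_conv:
  assumes "finite S" "barycentric w S z"
  shows "z \<in> conv S"
  using assms
proof (induction S arbitrary: w z rule: finite_induct)
  case empty
  then show ?case by (simp add: barycentric_def)
next
  case (insert a S)
  have z: "z = w a *s a + (\<Sum>v\<in>S. w v *s v)" and one: "w a + sum w S = 1"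
    and pos: "0 \<le> w a" "\<forall>v\<in>S. 0 \<le> w v"
    using insert.prems insert.hyps by (auto simp: barycentric_def)
  show ?case
  proof (cases "sum w S = 0")
    case True
    then have "\<forall>v\<in>S. w v = 0" using pos insert.hyps by (simp add: sum_nonneg_eq_0_iff)
    then have "z = a" using z one True by simp
    then show ?thesis by (simp add: hull_inc)
  next
    case False
    define r where "r = sum w S"
    have r: "r > 0" using False pos sum_nonneg[of S w] unfolding r_def by force
    have "barycentric (\<lambda>v. w v / r) S (inverse r *s (\<Sum>v\<in>S. w v *s v))"
      using barycentric_rescale[of S w r] pos r r_def by blast
    then have "inverse r *s (\<Sum>v\<in>S. w v *s v) \<in> conv (insert a S)"
      using insert.IH hull_mono[of S "insert a S"] by blast
    from conv_combination[OF _ this, of a "w a"] pos r one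
    have "w a *s a + (1 - w a) *s (inverse r *s (\<Sum>v\<in>S. w v *s v)) \<in> conv (insert a S)"
      by (simp add: hull_inc r_def)
    moreover have "1 - w a = r" using one r_def by simp
    ultimately show ?thesis using z r by simp
  qed
qed

lemma mem_conv: "finite S \<Longrightarrow> z \<in> conv S \<longleftrightarrow> (\<exists>w. barycentric w S z)"
  using conv_subset_barycentric barycentric_imp_conv by blast

lemma barycentric_insertD:
  assumes "finite S" "p \<notin> S" "barycentric w (insert p S) z" "z \<noteq> p"
  shows "0 \<le> w p" "w p < 1" "\<exists>x\<in>conv S. z = w p *s p + (1 - w p) *s x"
proof -
  have w: "w p *s p + (\<Sum>v\<in>S. w v *s v) = z" "w p + sum w S = 1" "0 \<le> w p" "\<forall>v\<in>S. 0 \<le> w v"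
    using assms by (auto simp: barycentric_def)
  define r where "r = 1 - w p"
  have "r \<noteq> 0"
  proof
    assume r0: "r = 0"
    then have "sum w S = 0" using w unfolding r_def by simp
    then have "\<forall>v\<in>S. w v = 0" using w assms by (simp add: sum_nonneg_eq_0_iff)
    then show False using w(1) r0 assms(4) unfolding r_def by simp
  qed
  moreover have "r \<ge> 0" using w sum_nonneg[of S w] unfolding r_def by auto
  ultimately have r: "r > 0" by simp
  have "barycentric (\<lambda>v. w v / r) S (inverse r *s (\<Sum>v\<in>S. w v *s v))"
    using barycentric_rescale[of S w r] w r r_def by fastforce
  then have "inverse r *s (\<Sum>v\<in>S. w v *s v) \<in> conv S" using assms mem_conv by blast
  moreover have "z = w p *s p + (1 - w p) *s (inverse r *s (\<Sum>v\<in>S. w v *s v))"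
    using w(1) r unfolding r_def by simp
  ultimately show "\<exists>x\<in>conv S. z = w p *s p + (1 - w p) *s x" by blast
  show "0 \<le> w p" "w p < 1" using w(3) r by (auto simp: r_def)
qed

text \<open>
  A polytope over one more point \<open>p\<close> consists of \<open>p\<close> and the segments joining \<open>p\<close> to the old polytope.
  The weight of \<open>p\<close> is the position on the segment, which is why the lemmas on either side of this
  one keep track of it.
\<close>
lemma mem_conv_insert:
  assumes "finite S" "p \<notin> S" "z \<in> conv (insert p S)" "z \<noteq> p"
  obtains u x where "0 \<le> u" "u < 1" "x \<in> conv S" "z = u *s p + (1 - u) *s x"
proof -
  obtain w where "barycentric w (insert p S) z"
    using assms mem_conv[of "insert p S" z] by auto
  from barycentric_insertD[OF assms(1,2) this assms(4)] show ?thesis using that by blast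
qed

lemma barycentric_insertI:
  assumes "finite S" "p \<notin> S" "x \<in> conv S" "0 \<le> u" "u \<le> 1"
  obtains w where "barycentric w (insert p S) (u *s p + (1 - u) *s x)" "w p = u"
proof -
  obtain w where w: "barycentric w S x" using assms mem_conv by blast
  define w' where "w' v = (if v = p then u else (1 - u) * w v)" for v
  have *: "w' v = (1 - u) * w v" if "v \<in> S" for v using that assms by (auto simp: w'_def)
  have "w' p = u" by (simp add: w'_def)
  moreover have "barycentric w' (insert p S) (u *s p + (1 - u) *s x)"
  proof -
    have "sum w' S = 1 - u" using w * by (simp add: barycentric_def flip: sum_distrib_left)
    moreover have "(\<Sum>v\<in>S. w' v *s v) = (1 - u) *s x"
    proof -
      have "(\<Sum>v\<in>S. w' v *s v) = (\<Sum>v\<in>S. (1 - u) *s (w v *s v))"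
        using * by (intro sum.cong) auto
      then show ?thesis using w by (simp only: barycentric_def vec.scale_sum_right[symmetric])
    qed
    ultimately show ?thesis
      using w assms * \<open>w' p = u\<close> by (auto simp: barycentric_def)
  qed
  ultimately show ?thesis using that by blast
qed

lemma barycentric_extend:
  assumes "finite A" "V \<subseteq> A" "barycentric w V z"
  shows "barycentric (\<lambda>v. if v \<in> V then w v else 0) A z"
  using assms
  by (auto simp: barycentric_def if_distrib[of "\<lambda>c. c *s _"] sum.inter_restrict[symmetric]
      Int_absorb1 cong: if_cong)

lemma barycentric_positive_part:
  assumes "finite V" "barycentric w V z"
  shows "barycentric w {v\<in>V. 0 < w v} z"
proof -
  have zero: "\<forall>v\<in>V - {v\<in>V. 0 < w v}. w v = 0" using assms by (force simp: barycentric_def)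
  have "sum w {v\<in>V. 0 < w v} = sum w V"
    by (rule sum.mono_neutral_left[OF assms(1) _ zero]) blast
  moreover have "(\<Sum>v\<in>{v\<in>V. 0 < w v}. w v *s v) = (\<Sum>v\<in>V. w v *s v)"
    by (rule sum.mono_neutral_left[OF assms(1)])
      (blast, metis zero vec.scale_zero_left)
  ultimately show ?thesis using assms(2) by (simp add: barycentric_def)
qed

lemma rat_aff_indep_weights_unique:
  assumes "rat_aff_indep V" "sum w V = sum w' V" "(\<Sum>v\<in>V. w v *s v) = (\<Sum>v\<in>V. w' v *s v)" "v \<in> V"
  shows "w v = w' v"
proof -
  have "sum (\<lambda>v. w v - w' v) V = 0" "(\<Sum>v\<in>V. (w v - w' v) *s v) = 0"
    using assms by (auto simp: sum_subtractf vec.scale_left_diff_distrib)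
  then show ?thesis using assms unfolding rat_aff_indep_def by force
qed

lemma rat_aff_indep_subset:
  assumes "rat_aff_indep V" "W \<subseteq> V"
  shows "rat_aff_indep W"
  unfolding rat_aff_indep_def
proof (intro conjI allI impI)
  have fin: "finite V" using assms by (simp add: rat_aff_indep_def)
  then show "finite W" using assms finite_subset by blast
  fix u assume u: "sum u W = 0 \<and> (\<Sum>v\<in>W. u v *s v) = 0"
  define u' where "u' v = (if v \<in> W then u v else 0)" for v
  have "sum u' V = 0" "(\<Sum>v\<in>V. u' v *s v) = 0"
    using u assms(2) fin
    by (auto simp: u'_def if_distrib[of "\<lambda>c. c *s _"] sum.inter_restrict[symmetric] Int_absorb1 cong: if_cong)
  then have "\<forall>v\<in>V. u' v = 0" using assms unfolding rat_aff_indep_def by blast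
  then show "\<forall>v\<in>W. u v = 0" using assms(2) unfolding u'_def by (metis subsetD)
qed

section \<open>Linear optimization over barycentric weights\<close>

text \<open>
  Along an affine dependence \<open>u\<close> of the support the represented point stays fixed and the cost
  changes linearly, so one of the directions \<open>u\<close>, \<open>- u\<close> does not increase it. As \<open>u\<close> sums to zero,
  some weight decreases in that direction; going on until the first weight vanishes shrinks the
  support.
\<close>
lemma caratheodory_with_cost:
  assumes "finite A" "barycentric w A z"
  shows "\<exists>V w'. V \<subseteq> A \<and> rat_aff_indep V \<and> barycentric w' V z
           \<and> (\<Sum>v\<in>V. w' v * g v) \<le> (\<Sum>v\<in>A. w v * g v)"
  using assms
proof (induction "card A" arbitrary: A w)
  case 0
  then show ?case by (auto simp: barycentric_def)
next
  case (Suc n)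
  show ?case
  proof (cases "rat_aff_indep A")
    case True
    then show ?thesis using Suc.prems by blast
  next
    case False
    then obtain u0 where u0: "sum u0 A = 0" "(\<Sum>v\<in>A. u0 v *s v) = 0" "\<exists>v\<in>A. u0 v \<noteq> 0"
      using Suc.prems unfolding rat_aff_indep_def by blast
    obtain u where u: "sum u A = 0" "(\<Sum>v\<in>A. u v *s v) = 0" "\<exists>v\<in>A. u v \<noteq> 0"
        "(\<Sum>v\<in>A. u v * g v) \<le> 0"
    proof (cases "(\<Sum>v\<in>A. u0 v * g v) \<le> 0")
      case True
      then show ?thesis using that[of u0] u0 by blast
    next
      case False
      then show ?thesis using that[of "\<lambda>v. - u0 v"] u0 by (simp add: sum_negf)
    qed
    define N where "N = {v\<in>A. u v < 0}"
    have finN: "finite N" using Suc.prems by (simp add: N_def)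
    have "N \<noteq> {}"
    proof
      assume "N = {}"
      then have "\<forall>v\<in>A. 0 \<le> u v" by (auto simp: N_def not_less)
      then show False using u Suc.prems by (simp add: sum_nonneg_eq_0_iff)
    qed
    \<comment> \<open>The step length at which the first of the decreasing weights reaches zero.\<close>
    define h where "h = Min ((\<lambda>v. w v / - u v) ` N)"
    have "h \<in> (\<lambda>v. w v / - u v) ` N"
      using finN \<open>N \<noteq> {}\<close> unfolding h_def by (intro Min_in) auto
    then obtain a where a: "a \<in> N" "h = w a / - u a" by blast
    have hle: "h \<le> w v / - u v" if "v \<in> N" for v
      using finN that unfolding h_def by (intro Min_le) auto
    have wpos: "\<forall>v\<in>A. 0 \<le> w v" using Suc.prems by (simp add: barycentric_def)
    have h0: "0 \<le> h" using a wpos unfolding N_def by (auto intro!: divide_nonneg_pos simp del: divide_minus_right)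
    define w' where "w' v = w v + h * u v" for v
    have w'pos: "0 \<le> w' v" if "v \<in> A" for v
    proof (cases "u v < 0")
      case True
      then show ?thesis using hle[of v] that unfolding w'_def N_def by (simp add: field_simps)
    next
      case False
      then show ?thesis using h0 wpos that unfolding w'_def by simp
    qed
    have aA: "a \<in> A" "w' a = 0" using a unfolding w'_def N_def by auto
    have s1: "sum w' A = 1"
      using u Suc.prems by (simp add: w'_def barycentric_def sum.distrib flip: sum_distrib_left)
    have s2: "(\<Sum>v\<in>A. w' v *s v) = z"
    proof -
      have "(\<Sum>v\<in>A. w' v *s v) = (\<Sum>v\<in>A. w v *s v) + h *s (\<Sum>v\<in>A. u v *s v)"
        by (simp add: w'_def vec.scale_left_distrib sum.distrib vec.scale_sum_right)
      then show ?thesis using u Suc.prems by (simp add: barycentric_def)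
    qed
    have s3: "(\<Sum>v\<in>A. w' v * g v) \<le> (\<Sum>v\<in>A. w v * g v)"
    proof -
      have "(\<Sum>v\<in>A. w' v * g v) = (\<Sum>v\<in>A. w v * g v) + h * (\<Sum>v\<in>A. u v * g v)"
        by (simp add: w'_def algebra_simps sum.distrib sum_distrib_left)
      then show ?thesis using u h0 by (simp add: mult_nonneg_nonpos)
    qed
    have "barycentric w' (A - {a}) z"
      using s1 s2 w'pos aA Suc.prems by (auto simp: barycentric_def sum.remove[of A a])
    moreover have "n = card (A - {a})" "finite (A - {a})" using Suc.hyps(2) Suc.prems aA by auto
    moreover have "(\<Sum>v\<in>A - {a}. w' v * g v) = (\<Sum>v\<in>A. w' v * g v)"
      using aA Suc.prems by (simp add: sum.remove[of A a])
    ultimately obtain V w'' where "V \<subseteq> A - {a}" "rat_aff_indep V" "barycentric w'' V z"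
        "(\<Sum>v\<in>V. w'' v * g v) \<le> (\<Sum>v\<in>A. w' v * g v)"
      using Suc.hyps(1)[of "A - {a}" w'] by auto
    then show ?thesis using s3 by (intro exI[of _ V] exI[of _ w'']) auto
  qed
qed

text \<open>
  Every attainable cost is bounded below by one attained on an affinely independent support, and
  there the weights are unique. So finitely many costs compete for the minimum.
\<close>
lemma barycentric_cost_minimum:
  assumes "finite A" "z \<in> conv A"
  obtains w where "barycentric w A z"
    and "\<And>w'. barycentric w' A z \<Longrightarrow> (\<Sum>v\<in>A. w v * g v) \<le> (\<Sum>v\<in>A. w' v * g v)"
proof -
  define C where "C V = {\<Sum>v\<in>V. w v * g v | w. barycentric w V z}" for V
  define I where "I = {V. V \<subseteq> A \<and> rat_aff_indep V}"
  have finI: "finite I" using assms by (simp add: I_def)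
  have "finite (C V)" if "V \<in> I" for V
  proof (cases "C V = {}")
    case False
    then obtain w where w: "barycentric w V z" by (auto simp: C_def)
    have "C V \<subseteq> {\<Sum>v\<in>V. w v * g v}"
    proof
      fix c assume "c \<in> C V"
      then obtain w' where w': "c = (\<Sum>v\<in>V. w' v * g v)" "barycentric w' V z" by (auto simp: C_def)
      have "\<forall>v\<in>V. w' v = w v"
        using rat_aff_indep_weights_unique[of V w' w] w w'(2) that by (auto simp: barycentric_def I_def)
      then show "c \<in> {\<Sum>v\<in>V. w v * g v}" using w'(1) by simp
    qed
    then show ?thesis using finite_subset by blast
  qed simp
  then have fin: "finite (\<Union>V\<in>I. C V)" using finI by blast
  have ex: "\<exists>c \<in> (\<Union>V\<in>I. C V). c \<le> (\<Sum>v\<in>A. w v * g v)" if "barycentric w A z" for w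
    using caratheodory_with_cost[OF assms(1) that, of g] unfolding I_def C_def by blast
  obtain w0 where "barycentric w0 A z" using assms mem_conv by blast
  then have ne: "(\<Union>V\<in>I. C V) \<noteq> {}" using ex by blast
  obtain V w where Vw: "V \<in> I" "barycentric w V z" "Min (\<Union>V\<in>I. C V) = (\<Sum>v\<in>V. w v * g v)"
    using Min_in[OF fin ne] by (auto simp: C_def)
  define w' where "w' v = (if v \<in> V then w v else 0)" for v
  have VA: "V \<subseteq> A" using Vw by (simp add: I_def)
  have "barycentric w' A z" "(\<Sum>v\<in>A. w' v * g v) = (\<Sum>v\<in>V. w v * g v)"
    using Vw(2) VA assms(1)
    by (auto simp: w'_def barycentric_def if_distrib[of "\<lambda>c. c *s _"] if_distrib[of "\<lambda>c. c * _"]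
        sum.inter_restrict[symmetric] Int_absorb1 cong: if_cong)
  moreover have "Min (\<Union>V\<in>I. C V) \<le> (\<Sum>v\<in>A. w v * g v)" if "barycentric w A z" for w
    using ex[OF that] Min_le[OF fin] by (meson order_trans)
  ultimately show ?thesis using that[of w'] Vw(3) by auto
qed

section \<open>Points of a polytope seen from outside\<close>

text \<open>
  With \<open>x \<in> Q\<close> in mind: walking from \<open>x\<close> towards \<open>p\<close> leaves \<open>Q\<close> at once and never
  returns, so \<open>x\<close> is the first point of \<open>Q\<close> on the ray from \<open>p\<close> through \<open>x\<close>.
\<close>
definition visible :: "rat ^ 'd \<Rightarrow> (rat ^ 'd) set \<Rightarrow> rat ^ 'd \<Rightarrow> bool" where
  "visible p Q x \<longleftrightarrow> (\<forall>u. 0 < u \<and> u \<le> 1 \<longrightarrow> u *s p + (1 - u) *s x \<notin> Q)"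

text \<open>
  Both points lie on one line through \<open>p\<close>, and the smaller weight of \<open>p\<close> puts \<open>x\<close> strictly between
  \<open>x'\<close> and \<open>p\<close> (or at \<open>p\<close>), where the visible point \<open>x'\<close> leaves no room for points of \<open>Q\<close>.
\<close>
lemma visible_not_behind:
  assumes "u *s p + (1 - u) *s x = u' *s p + (1 - u') *s x'"
    and "u < u'" "u' \<le> 1" "x \<in> Q" "visible p Q x'"
  shows False
proof -
  define t where "t = (u' - u) / (1 - u)"
  have t: "0 < t" "t \<le> 1" using assms(2,3) by (auto simp: t_def divide_simps)
  have "x $ i = t * p $ i + (1 - t) * x' $ i" for i
  proof -
    have "u * p $ i + (1 - u) * x $ i = u' * p $ i + (1 - u') * x' $ i"
      using arg_cong[OF assms(1), of "\<lambda>y. y $ i"] by (simp add: algebra_simps)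
    then have e: "(1 - u) * x $ i = (u' - u) * p $ i + (1 - u') * x' $ i" by (simp add: algebra_simps)
    have d: "1 - u > 0" "u' - u = t * (1 - u)" "1 - u' = (1 - t) * (1 - u)"
      using assms(2,3) by (auto simp: t_def field_simps)
    have "(1 - u) * x $ i = (1 - u) * (t * p $ i + (1 - t) * x' $ i)"
      unfolding e d(2,3) by (simp add: algebra_simps)
    then show ?thesis using d(1) by simp
  qed
  then have "x = t *s p + (1 - t) *s x'" by (simp add: vec_eq_iff algebra_simps)
  then show False using assms(4,5) t unfolding visible_def by auto
qed

lemma visible_unique:
  assumes "u *s p + (1 - u) *s x = u' *s p + (1 - u') *s x'"
    and "u < 1" "u' < 1" "x \<in> Q" "x' \<in> Q" "visible p Q x" "visible p Q x'"
  shows "x = x'"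
proof -
  have "u = u'"
    using visible_not_behind[OF assms(1)] visible_not_behind[OF assms(1)[symmetric]] assms
    by (meson less_imp_le linorder_neqE)
  then have "(1 - u) *s x = (1 - u) *s x'" using assms(1) by simp
  then show ?thesis using assms(2) by (simp only: vec.scale_cancel_left) simp
qed

text \<open>
  Among all ways to write \<open>z\<close> as a point of a segment from \<open>p\<close> to a point of the polytope, take one
  where \<open>p\<close> has the least weight: then the end point of the segment is as close to \<open>p\<close> as possible. A
  point of the polytope further towards \<open>p\<close> would either allow a smaller weight or, lying beyond \<open>z\<close>,
  force \<open>z\<close> into the polytope by convexity.
\<close>
lemma exists_visible_point:
  assumes "finite A" "p \<notin> conv A" "z \<in> conv (insert p A)" "z \<notin> conv A" "z \<noteq> p"
  obtains u x where "0 \<le> u" "u < 1" "x \<in> conv A" "visible p (conv A) x"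
    "z = u *s p + (1 - u) *s x"
proof -
  have pA: "p \<notin> A" using assms(2) by (meson hull_inc)
  obtain w where w: "barycentric w (insert p A) z"
    and min: "\<And>w'. barycentric w' (insert p A) z \<Longrightarrow>
      (\<Sum>v\<in>insert p A. w v * (if v = p then 1 else 0)) \<le> (\<Sum>v\<in>insert p A. w' v * (if v = p then 1 else 0))"
    using barycentric_cost_minimum[of "insert p A" z "\<lambda>v. if v = p then 1 else 0"] assms by auto
  have cost: "(\<Sum>v\<in>insert p A. w v * (if v = p then 1 else 0)) = w p" for w :: "rat ^ 'a \<Rightarrow> rat"
    using assms(1) by (simp add: if_distrib[of "\<lambda>c. _ * c"] cong: if_cong)
  define u where "u = w p"
  obtain x where x: "0 \<le> u" "u < 1" "x \<in> conv A" "z = u *s p + (1 - u) *s x"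
    using barycentric_insertD[OF assms(1) pA w assms(5)] unfolding u_def by blast
  have "visible p (conv A) x"
    unfolding visible_def
  proof (intro allI impI notI)
    fix t :: rat assume t: "0 < t \<and> t \<le> 1" and q: "t *s p + (1 - t) *s x \<in> conv A"
    have t1: "t < 1" using t q assms(2) by (cases "t = 1") auto
    \<comment> \<open>The found point lies before \<open>z\<close> on the way to \<open>p\<close>; otherwise \<open>z\<close> is between \<open>x\<close> and it.\<close>
    have "t < u"
    proof (rule ccontr)
      assume "\<not> t < u"
      then have "(u / t) *s (t *s p + (1 - t) *s x) + (1 - u / t) *s x \<in> conv A"
        using conv_combination[OF q x(3), of "u / t"] t x(1) by (simp add: divide_simps)
      moreover have "(u / t) *s (t *s p + (1 - t) *s x) + (1 - u / t) *s x = z"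
        unfolding x(4) vec_eq_iff using t by (simp add: field_simps)
      ultimately show False using assms(4) by simp
    qed
    \<comment> \<open>The weight of \<open>p\<close> when \<open>z\<close> is written with the found point in place of \<open>x\<close>.\<close>
    define s where "s = (u - t) / (1 - t)"
    have s: "0 \<le> s" "s \<le> 1" "s < u"
    proof -
      have "t * u < t * 1" using t x(2) by (intro mult_strict_left_mono) auto
      then show "s < u" using t1 by (simp add: s_def divide_simps algebra_simps)
    qed (use \<open>t < u\<close> t1 x in \<open>auto simp: s_def divide_simps\<close>)
    have e: "u - t = s * (1 - t)" using t1 by (simp add: s_def)
    have "s *s p + (1 - s) *s (t *s p + (1 - t) *s x) = z"
    proof -
      have "s * a + (1 - s) * (t * a + (1 - t) * b) = u * a + (1 - u) * b" for a b :: rat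
      proof -
        have "s * a + (1 - s) * (t * a + (1 - t) * b) - (t * a + (1 - t) * b) = (s * (1 - t)) * (a - b)"
          by (simp add: algebra_simps)
        then show ?thesis unfolding e[symmetric] by (simp add: algebra_simps)
      qed
      then show ?thesis unfolding x(4) vec_eq_iff by (simp only: vector_add_component vector_smult_component) simp
    qed
    moreover obtain w' where "barycentric w' (insert p A) (s *s p + (1 - s) *s (t *s p + (1 - t) *s x))" "w' p = s"
      using barycentric_insertI[OF assms(1) pA q s(1,2)] by blast
    ultimately have "u \<le> s" using min[of w'] unfolding cost u_def by simp
    then show False using s by simp
  qed
  then show ?thesis using that x by blast
qed

text \<open>
  If moving \<open>y\<close> towards \<open>p\<close> stays in the polytope, then by convexity so does the whole triangle with
  the moved point, \<open>y\<close> and \<open>y'\<close>, and with it a point on the way from \<open>d y + (1 - d) y'\<close> to \<open>p\<close>.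
\<close>
lemma visible_along_segment:
  assumes "visible p (conv A) (d *s y + (1 - d) *s y')" "y' \<in> conv A" "0 < d" "d \<le> 1"
  shows "visible p (conv A) y"
  unfolding visible_def
proof (intro allI impI notI)
  fix e :: rat assume e: "0 < e \<and> e \<le> 1" and q: "e *s p + (1 - e) *s y \<in> conv A"
  have de: "0 < d * e" "d * e \<le> 1" using assms e by (auto simp: mult_le_one)
  \<comment> \<open>The segment from \<open>x = d y + (1 - d) y'\<close> to \<open>p\<close> meets the segment from \<open>y'\<close> to \<open>e p + (1 - e) y\<close>
    where \<open>p\<close> has weight \<open>t\<close> on the former and \<open>e p + (1 - e) y\<close> has weight \<open>s\<close> on the latter.\<close>
  define D where "D = 1 - e + d * e"
  have D: "D > 0" using de e by (simp add: D_def)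
  define t where "t = d * e / D"
  define s where "s = d / D"
  have t: "0 < t" "t \<le> 1" using de D e by (auto simp: t_def D_def)
  have dD: "d \<le> D"
  proof -
    have "D - d = (1 - d) * (1 - e)" by (simp add: D_def algebra_simps)
    then show ?thesis using assms e by (smt (verit) diff_ge_0_iff_ge mult_nonneg_nonneg)
  qed
  then have s: "0 \<le> s" "s \<le> 1" using assms D by (auto simp: s_def)
  have "s *s (e *s p + (1 - e) *s y) + (1 - s) *s y' \<in> conv A"
    using conv_combination[OF q assms(2) s] .
  moreover have "s *s (e *s p + (1 - e) *s y) + (1 - s) *s y' = t *s p + (1 - t) *s (d *s y + (1 - d) *s y')"
  proof -
    have 1: "s * e = t" by (simp add: s_def t_def)
    have 2: "s * (1 - e) = (1 - t) * d" "1 - s = (1 - t) * (1 - d)"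
      using D by (simp_all add: s_def t_def divide_simps) (simp_all add: D_def algebra_simps)
    have "s * (e * a + (1 - e) * b) + (1 - s) * c = t * a + (1 - t) * (d * b + (1 - d) * c)" for a b c
    proof -
      have "s * (e * a + (1 - e) * b) + (1 - s) * c = (s * e) * a + (s * (1 - e)) * b + (1 - s) * c"
        by (simp add: algebra_simps)
      then show ?thesis unfolding 1 2 by (simp add: algebra_simps)
    qed
    then show ?thesis unfolding vec_eq_iff by (simp only: vector_add_component vector_smult_component) simp
  qed
  ultimately show False using assms(1) t unfolding visible_def by metis
qed

text \<open>
  A point \<open>x\<close> with positive weights on all of \<open>F\<close> is interior to a segment from any given \<open>y\<close> in the
  hull of \<open>F\<close> to another point of that hull, so visibility passes from \<open>x\<close> to \<open>y\<close>.
\<close>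
lemma visible_whole_face:
  assumes "finite F" "F \<subseteq> conv A" "barycentric w F x" "\<forall>v\<in>F. 0 < w v" "visible p (conv A) x"
    "y \<in> conv F"
  shows "visible p (conv A) y"
proof -
  obtain b where b: "barycentric b F y" using assms mem_conv by blast
  have "F \<noteq> {}" using b by (auto simp: barycentric_def)
  \<comment> \<open>Half the least weight keeps \<open>w - d b\<close> nonnegative and \<open>d\<close> below one.\<close>
  define d where "d = Min (w ` F) / 2"
  have dmin: "d \<le> w v / 2" if "v \<in> F" for v using that assms(1) by (simp add: d_def)
  have "Min (w ` F) \<in> w ` F" using assms(1) \<open>F \<noteq> {}\<close> by (intro Min_in) auto
  then have d0: "0 < d" using assms(4) unfolding d_def by auto
  have le1: "c v \<le> 1" if "barycentric c F q" "v \<in> F" for c q v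
    using that assms(1) member_le_sum[of v F c] by (auto simp: barycentric_def)
  obtain v0 where "v0 \<in> F" using \<open>F \<noteq> {}\<close> by blast
  then have d1: "d \<le> 1/2" using dmin[of v0] le1[OF assms(3), of v0] by simp
  have pos: "0 \<le> w v - d * b v" if "v \<in> F" for v
  proof -
    have "d * b v \<le> d * 1" using le1[OF b that] d0 by (intro mult_left_mono) auto
    then show ?thesis using dmin[OF that] assms(4) that by force
  qed
  have "barycentric (\<lambda>v. (w v - d * b v) / (1 - d)) F (inverse (1 - d) *s (\<Sum>v\<in>F. (w v - d * b v) *s v))"
  proof (rule barycentric_rescale)
    show "(\<Sum>v\<in>F. w v - d * b v) = 1 - d"
      using assms(3) b by (simp add: barycentric_def sum_subtractf flip: sum_distrib_left)
  qed (use pos d1 in auto)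
  then have y': "inverse (1 - d) *s (\<Sum>v\<in>F. (w v - d * b v) *s v) \<in> conv A"
    using barycentric_imp_conv[OF assms(1)] conv_subset_conv[OF assms(2)] by blast
  have "(\<Sum>v\<in>F. (w v - d * b v) *s v) = x - d *s y"
    using assms(3) b by (auto simp: barycentric_def sum_subtractf vec.scale_left_diff_distrib vec.scale_sum_right)
  then have "x = d *s y + (1 - d) *s (inverse (1 - d) *s (\<Sum>v\<in>F. (w v - d * b v) *s v))"
    using d1 by simp
  then show ?thesis using visible_along_segment[of p A d y, OF _ y'] assms(5) d0 d1 by auto
qed

lemma aff_dependent_insert:
  assumes "rat_aff_indep F" "p \<notin> F" "\<not> rat_aff_indep (insert p F)"
  obtains c where "sum c F = 1" "(\<Sum>v\<in>F. c v *s v) = p"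
proof -
  have fin: "finite F" using assms(1) by (simp add: rat_aff_indep_def)
  obtain u where "sum u (insert p F) = 0" "(\<Sum>v\<in>insert p F. u v *s v) = 0"
      and nz: "\<exists>v\<in>insert p F. u v \<noteq> 0"
    using assms(3) fin unfolding rat_aff_indep_def by blast
  then have u: "u p + sum u F = 0" "u p *s p + (\<Sum>v\<in>F. u v *s v) = 0"
    using fin assms(2) by auto
  have up: "u p \<noteq> 0"
  proof
    assume "u p = 0"
    then have "\<forall>v\<in>F. u v = 0" using u assms(1) unfolding rat_aff_indep_def by simp
    then show False using nz \<open>u p = 0\<close> by simp
  qed
  define c where "c v = - u v / u p" for v
  have "sum c F = 1"
  proof -
    have "sum c F = - sum u F / u p" by (simp add: c_def sum_negf sum_divide_distrib)
    moreover have "- sum u F = u p" using u(1) by (simp add: eq_neg_iff_add_eq_0)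
    ultimately show ?thesis using up by simp
  qed
  moreover have "(\<Sum>v\<in>F. c v *s v) = p"
  proof -
    have "(\<Sum>v\<in>F. c v *s v) = (- inverse (u p)) *s (\<Sum>v\<in>F. u v *s v)"
      by (simp add: c_def vec.scale_sum_right divide_inverse mult.commute sum_negf)
    also have "(\<Sum>v\<in>F. u v *s v) = (- u p) *s p"
      using u(2) by (simp add: eq_neg_iff_add_eq_0 add.commute)
    finally show ?thesis using up by simp
  qed
  ultimately show ?thesis using that by blast
qed

text \<open>
  If \<open>p\<close> were in the affine span of the face, moving from the barycenter of the face slightly
  towards \<open>p\<close> would stay inside the face.
\<close>
lemma visible_imp_affinely_independent:
  assumes "rat_aff_indep F" "conv F \<subseteq> Q" "p \<notin> F" "\<forall>x\<in>conv F. visible p Q x"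
  shows "rat_aff_indep (insert p F)"
proof (rule ccontr)
  assume "\<not> rat_aff_indep (insert p F)"
  then obtain c where c1: "sum c F = 1" and cp: "(\<Sum>v\<in>F. c v *s v) = p"
    using aff_dependent_insert assms(1,3) by blast
  have fin: "finite F" using assms by (simp add: rat_aff_indep_def)
  have "F \<noteq> {}" using c1 by auto
  define n where "n = (of_nat (card F) :: rat)"
  have n: "n > 0" using fin \<open>F \<noteq> {}\<close> by (simp add: n_def card_gt_0_iff)
  define M where "M = (\<Sum>v\<in>F. \<bar>c v\<bar>)"
  have M: "\<bar>c v\<bar> \<le> M" if "v \<in> F" for v
    using that fin unfolding M_def by (intro member_le_sum) auto
  have M0: "M \<ge> 0" by (simp add: M_def sum_nonneg)
  \<comment> \<open>For this \<open>t\<close> the weights \<open>(1 - t) / n\<close> of the barycenter just compensate coefficients of \<open>p\<close> down to \<open>- M\<close>.\<close>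
  define t where "t = 1 / (1 + n * M)"
  have den: "1 + n * M > 0" using n M0 by (simp add: add_pos_nonneg)
  have t: "0 < t" "t \<le> 1" using n M0 by (auto simp: t_def add_pos_nonneg)
  have "t * (1 + n * M) = 1" using den by (simp add: t_def)
  then have "1 - t = (t * M) * n" by (simp add: algebra_simps)
  then have tn: "(1 - t) / n = t * M" using n by simp
  define b where "b = (\<Sum>v\<in>F. (1 / n) *s v)"
  have bF: "b \<in> conv F"
    using fin n by (auto simp: mem_conv barycentric_def b_def n_def intro!: exI[of _ "\<lambda>_. 1 / n"])
  have "barycentric (\<lambda>v. t * c v + (1 - t) * (1 / n)) F (t *s p + (1 - t) *s b)"
    unfolding barycentric_def
  proof (intro conjI ballI)
    fix v assume "v \<in> F"
    then have "t * (- c v) \<le> t * M" using M[of v] t by (intro mult_left_mono) auto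
    then show "0 \<le> t * c v + (1 - t) * (1 / n)" using tn by simp
  next
    show "(\<Sum>v\<in>F. t * c v + (1 - t) * (1 / n)) = 1"
      using c1 n by (simp add: sum.distrib n_def flip: sum_distrib_left)
  next
    show "(\<Sum>v\<in>F. (t * c v + (1 - t) * (1 / n)) *s v) = t *s p + (1 - t) *s b"
      unfolding cp[symmetric] b_def vec.scale_sum_right
      by (simp add: sum.distrib[symmetric] vec.scale_left_distrib)
  qed
  then have "t *s p + (1 - t) *s b \<in> Q" using fin mem_conv assms(2) by blast
  then show False using assms(4) bF t unfolding visible_def by blast
qed

section \<open>Extending a simplex to a lattice triangulation\<close>

text \<open>
  The faces of a single simplex, the start of the placing triangulation. A point common to two
  faces has the same weights in both, hence lies in the hull of the common vertices.
\<close>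
lemma simplex_triangulation:
  assumes "rat_aff_indep V" "V \<subseteq> int_vecs"
  shows "lattice_triangulation {W. W \<subseteq> V \<and> W \<noteq> {}} (conv V)"
  unfolding lattice_triangulation_def
proof (intro conjI ballI allI impI)
  have fin: "finite V" using assms by (simp add: rat_aff_indep_def)
  then show "finite {W. W \<subseteq> V \<and> W \<noteq> {}}" by simp
  show "(\<Union>W\<in>{W. W \<subseteq> V \<and> W \<noteq> {}}. conv W) = conv V"
  proof
    show "(\<Union>W\<in>{W. W \<subseteq> V \<and> W \<noteq> {}}. conv W) \<subseteq> conv V" by (auto dest: hull_mono)
    show "conv V \<subseteq> (\<Union>W\<in>{W. W \<subseteq> V \<and> W \<noteq> {}}. conv W)"
      using conv_empty by (cases "V = {}") auto
  qed
  fix W W' assume W: "W \<in> {W. W \<subseteq> V \<and> W \<noteq> {}}" and W': "W' \<in> {W. W \<subseteq> V \<and> W \<noteq> {}}"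
  have fW: "finite W" "finite W'" using W W' fin finite_subset by auto
  show "conv W \<inter> conv W' = conv (W \<inter> W')"
  proof
    show "conv (W \<inter> W') \<subseteq> conv W \<inter> conv W'" by (simp add: hull_mono)
    show "conv W \<inter> conv W' \<subseteq> conv (W \<inter> W')"
    proof
      fix z assume "z \<in> conv W \<inter> conv W'"
      then obtain w w' where w: "barycentric w W z" and w': "barycentric w' W' z"
        using mem_conv fW by blast
      have eq: "(if v \<in> W then w v else 0) = (if v \<in> W' then w' v else 0)" if "v \<in> V" for v
        using rat_aff_indep_weights_unique[OF assms(1) _ _ that,
            of "\<lambda>v. if v \<in> W then w v else 0" "\<lambda>v. if v \<in> W' then w' v else 0"]
          barycentric_extend[OF fin _ w] barycentric_extend[OF fin _ w'] W W'
        unfolding barycentric_def by auto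
      have pos: "barycentric w {v\<in>W. 0 < w v} z" using barycentric_positive_part fW w by blast
      have "{v\<in>W. 0 < w v} \<subseteq> W \<inter> W'"
      proof
        fix v assume "v \<in> {v\<in>W. 0 < w v}"
        then show "v \<in> W \<inter> W'" using eq[of v] W by (auto split: if_splits)
      qed
      then show "z \<in> conv (W \<inter> W')"
        using barycentric_imp_conv[OF _ pos] fW(1) hull_mono[of "{v\<in>W. 0 < w v}" "W \<inter> W'"] by auto
    qed
  qed
qed (use assms rat_aff_indep_subset in auto)

text \<open>
  The new simplices are the cones with apex \<open>p\<close> over the visible faces. The empty face counts as
  visible, so that the vertex \<open>p\<close> itself is among them. The case that \<open>p\<close> is outside the affine
  span of \<open>A\<close> is included: then every face is visible.
\<close>
lemma extend_triangulation:
  assumes T: "lattice_triangulation T (conv A)" and fin: "finite A"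
    and p: "p \<in> int_vecs" "p \<notin> conv A"
  obtains T' where "T \<subseteq> T'" "lattice_triangulation T' (conv (insert p A))"
proof -
  define Q where "Q = conv A"
  define Vis where "Vis = {F \<in> insert {} T. \<forall>x\<in>conv F. visible p Q x}"
  define T' where "T' = T \<union> insert p ` Vis"
  note T = T[unfolded lattice_triangulation_def, folded Q_def]
  have finT: "finite T" using T by (elim conjE)
  have verts: "V \<noteq> {} \<and> V \<subseteq> int_vecs \<and> rat_aff_indep V" if "V \<in> T" for V
    using T that by (elim conjE) (rule bspec)
  have faces: "W \<in> T" if "V \<in> T" "W \<subseteq> V" "W \<noteq> {}" for V W
    using T that by (elim conjE) blast
  have cover: "(\<Union>V\<in>T. conv V) = Q" using T by (elim conjE)
  have meet: "conv V \<inter> conv W = conv (V \<inter> W)" if "V \<in> T" "W \<in> T" for V W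
    using T that by (elim conjE) (drule (1) bspec, drule (1) bspec, assumption)
  have indep0: "rat_aff_indep V" "V \<subseteq> int_vecs" "conv V \<subseteq> Q" "finite V" "V \<subseteq> Q"
    if "V \<in> insert {} T" for V
  proof -
    show "rat_aff_indep V" using that verts by (auto simp: rat_aff_indep_def)
    then show "finite V" by (simp add: rat_aff_indep_def)
    show "V \<subseteq> int_vecs" using that verts by auto
    show Q: "conv V \<subseteq> Q" using that cover by (auto simp: conv_empty)
    show "V \<subseteq> Q" using Q hull_subset[of V "rat_convex (*s)"] by blast
  qed
  have pn: "p \<notin> V" if "V \<in> insert {} T" for V using indep0(5)[OF that] p(2) unfolding Q_def by blast
  have meet0: "conv V \<inter> conv W = conv (V \<inter> W)" if "V \<in> insert {} T" "W \<in> insert {} T" for V W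
    using that meet by (auto simp: conv_empty)
  have vis: "F \<in> insert {} T" "\<And>x. x \<in> conv F \<Longrightarrow> visible p Q x" "finite F" "p \<notin> F"
      "\<And>x. x \<in> conv F \<Longrightarrow> x \<in> Q" if "F \<in> Vis" for F
  proof -
    show F: "F \<in> insert {} T" using that by (simp add: Vis_def)
    show "visible p Q x" if "x \<in> conv F" for x using \<open>F \<in> Vis\<close> that by (simp add: Vis_def)
    show "finite F" "p \<notin> F" using indep0(4)[OF F] pn[OF F] .
    show "x \<in> Q" if "x \<in> conv F" for x using indep0(3)[OF F] that by (rule subsetD)
  qed
  \<comment> \<open>A point of a cone over a visible face that lies in \<open>Q\<close> is on the face itself.\<close>
  have meet_old: "conv (insert p F) \<inter> conv G = conv (insert p F \<inter> G)" if F: "F \<in> Vis" and G: "G \<in> T" for F G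
  proof
    show "conv (insert p F \<inter> G) \<subseteq> conv (insert p F) \<inter> conv G" by (simp add: hull_mono)
    show "conv (insert p F) \<inter> conv G \<subseteq> conv (insert p F \<inter> G)"
    proof
      fix z assume z: "z \<in> conv (insert p F) \<inter> conv G"
      have zQ: "z \<in> Q" using z G indep0(3) by blast
      then have "z \<noteq> p" using p Q_def by blast
      then obtain u x where u: "0 \<le> u" "u < 1" "x \<in> conv F" "z = u *s p + (1 - u) *s x"
        using mem_conv_insert[of F p z] vis[OF F] z by blast
      have "u = 0"
      proof (rule ccontr)
        assume "u \<noteq> 0"
        then have "0 < u \<and> u \<le> 1" using u by simp
        then have "u *s p + (1 - u) *s x \<notin> Q" using vis(2)[OF F u(3)] unfolding visible_def by blast
        then show False using zQ by (simp only: u(4))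
      qed
      then have "z \<in> conv F \<inter> conv G" using u z by simp
      then have "z \<in> conv (F \<inter> G)" using meet0 vis(1)[OF F] G by auto
      then show "z \<in> conv (insert p F \<inter> G)"
        using hull_mono[of "F \<inter> G" "insert p F \<inter> G"] by blast
    qed
  qed
  have meet_new: "conv (insert p F) \<inter> conv (insert p G) = conv (insert p F \<inter> insert p G)"
    if F: "F \<in> Vis" and G: "G \<in> Vis" for F G
  proof
    show "conv (insert p F \<inter> insert p G) \<subseteq> conv (insert p F) \<inter> conv (insert p G)"
      by (intro Int_greatest hull_mono) auto
    show "conv (insert p F) \<inter> conv (insert p G) \<subseteq> conv (insert p F \<inter> insert p G)"
    proof
      fix z assume z: "z \<in> conv (insert p F) \<inter> conv (insert p G)"
      show "z \<in> conv (insert p F \<inter> insert p G)"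
      proof (cases "z = p")
        case True
        then show ?thesis by (simp add: hull_inc)
      next
        case False
        obtain u x where u: "0 \<le> u" "u < 1" "x \<in> conv F" "z = u *s p + (1 - u) *s x"
          using mem_conv_insert[of F p z] vis[OF F] z False by blast
        obtain t y where t: "0 \<le> t" "t < 1" "y \<in> conv G" "z = t *s p + (1 - t) *s y"
          using mem_conv_insert[of G p z] vis[OF G] z False by blast
        have "x = y"
          using visible_unique[of u p x t y Q] u t vis(2,5)[OF F] vis(2,5)[OF G] by metis
        then have "x \<in> conv (F \<inter> G)" using u t meet0 vis(1)[OF F] vis(1)[OF G] by auto
        then have "x \<in> conv (insert p (F \<inter> G))" by (meson hull_mono subsetD subset_insertI)
        then have "u *s p + (1 - u) *s x \<in> conv (insert p (F \<inter> G))"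
          using u by (intro conv_combination) (auto simp: hull_inc)
        then show ?thesis using u(4) by simp
      qed
    qed
  qed
  have "lattice_triangulation T' (conv (insert p A))"
    unfolding lattice_triangulation_def
  proof (intro conjI ballI allI impI)
    show "finite T'" using finT by (simp add: T'_def Vis_def)
  next
    fix V assume V: "V \<in> T'"
    then consider "V \<in> T" | F where "F \<in> Vis" "V = insert p F" by (auto simp: T'_def)
    then have "V \<noteq> {} \<and> V \<subseteq> int_vecs \<and> rat_aff_indep V"
    proof cases
      case 1
      then show ?thesis using verts by blast
    next
      case 2
      then show ?thesis
        using visible_imp_affinely_independent[of F Q p] indep0[OF vis(1)[OF 2(1)]] vis[OF 2(1)] p(1) by auto
    qed
    then show "V \<noteq> {}" "V \<subseteq> int_vecs" "rat_aff_indep V" by auto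
  next
    fix V W assume V: "V \<in> T'" and W: "W \<subseteq> V \<and> W \<noteq> {}"
    then consider "V \<in> T" | F where "F \<in> Vis" "V = insert p F" by (auto simp: T'_def)
    then show "W \<in> T'"
    proof cases
      case 1
      then show ?thesis using faces W by (auto simp: T'_def)
    next
      case 2
      have F: "F \<in> insert {} T" "\<forall>x\<in>conv F. visible p Q x" using 2 by (auto simp: Vis_def)
      have sub: "W - {p} \<subseteq> F" using 2 W by auto
      then have T: "W - {p} \<in> insert {} T" using F faces by blast
      show ?thesis
      proof (cases "p \<in> W")
        case True
        have "conv (W - {p}) \<subseteq> conv F" using sub by (rule hull_mono)
        then have "W - {p} \<in> Vis" using T F unfolding Vis_def by blast
        then have "insert p (W - {p}) \<in> T'" unfolding T'_def by blast
        moreover have "insert p (W - {p}) = W" using True by blast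
        ultimately show ?thesis by simp
      next
        case False
        then show ?thesis using T W by (simp add: T'_def)
      qed
    qed
  next
    show "(\<Union>V\<in>T'. conv V) = conv (insert p A)"
    proof
      have Q: "Q \<subseteq> conv (insert p A)" unfolding Q_def by (rule hull_mono) blast
      have old: "V \<subseteq> conv (insert p A)" if "V \<in> insert {} T" for V
        using indep0(5)[OF that] Q by (rule order_trans)
      have "conv V \<subseteq> conv (insert p A)" if "V \<in> T'" for V
      proof (rule conv_subset_conv)
        show "V \<subseteq> conv (insert p A)"
          using that old vis(1) hull_inc[of p "insert p A"] unfolding T'_def by blast
      qed
      then show "(\<Union>V\<in>T'. conv V) \<subseteq> conv (insert p A)" by blast
      show "conv (insert p A) \<subseteq> (\<Union>V\<in>T'. conv V)"
      proof
        fix z assume z: "z \<in> conv (insert p A)"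
        consider "z = p" | "z \<in> Q" | "z \<noteq> p" "z \<notin> Q" by blast
        then show "z \<in> (\<Union>V\<in>T'. conv V)"
        proof cases
          case 1
          have "{} \<in> Vis" by (simp add: Vis_def conv_empty)
          then have "{p} \<in> T'" by (auto simp: T'_def)
          then show ?thesis using 1 hull_inc[of p "{p}"] by blast
        next
          case 2
          then show ?thesis using cover by (auto simp: T'_def)
        next
          case 3
          then obtain u x where u: "0 \<le> u" "u < 1" "x \<in> Q" "visible p Q x" "z = u *s p + (1 - u) *s x"
            using exists_visible_point[OF fin p(2) z] unfolding Q_def by blast
          obtain G where G: "G \<in> T" "x \<in> conv G" using u(3) cover by blast
          have fG: "finite G" using indep0(4) G by blast
          obtain w where "barycentric w G x" using G mem_conv fG by blast
          define F where "F = {v\<in>G. 0 < w v}"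
          have wF: "barycentric w F x"
            unfolding F_def using fG \<open>barycentric w G x\<close> by (rule barycentric_positive_part)
          have fF: "finite F" using fG by (simp add: F_def)
          have "F \<noteq> {}" using wF by (auto simp: barycentric_def)
          then have FT: "F \<in> T" using faces[OF G(1), of F] by (auto simp: F_def)
          have "visible p Q y" if "y \<in> conv F" for y
            unfolding Q_def
            by (rule visible_whole_face[OF fF _ wF _ _ that])
              (use indep0(5)[of F] FT u(4) in \<open>auto simp: F_def Q_def\<close>)
          then have "F \<in> Vis" using FT by (simp add: Vis_def)
          then have "insert p F \<in> T'" by (simp add: T'_def)
          moreover have "z \<in> conv (insert p F)"
            unfolding u(5)
          proof (rule conv_combination)
            show "x \<in> conv (insert p F)"
              using barycentric_imp_conv[OF fF wF] hull_mono[of F "insert p F"] by blast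
          qed (use u in \<open>auto simp: hull_inc\<close>)
          ultimately show ?thesis by blast
        qed
      qed
    qed
  next
    fix V W assume "V \<in> T'" "W \<in> T'"
    then consider "V \<in> T" "W \<in> T"
      | F where "F \<in> Vis" "V = insert p F" "W \<in> T"
      | G where "V \<in> T" "G \<in> Vis" "W = insert p G"
      | F G where "F \<in> Vis" "V = insert p F" "G \<in> Vis" "W = insert p G"
      unfolding T'_def by blast
    then show "conv V \<inter> conv W = conv (V \<inter> W)"
    proof cases
      case 1
      then show ?thesis by (rule meet)
    next
      case 2
      show ?thesis unfolding 2(2) using 2(1,3) by (rule meet_old)
    next
      case 3
      show ?thesis unfolding 3(3) Int_commute[of "conv V"] Int_commute[of V]
        using 3(2,1) by (rule meet_old)
    next
      case 4
      show ?thesis unfolding 4(2,4) using 4(1,3) by (rule meet_new)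
    qed
  qed
  then show ?thesis using that by (auto simp: T'_def)
qed

text \<open>
  A point already in the polytope built so far need not become a vertex: it can be skipped, as
  a lattice triangulation may leave lattice points unused.
\<close>
lemma simplex_in_triangulation:
  assumes "finite A" "A \<subseteq> int_vecs" "V \<subseteq> A" "V \<noteq> {}" "rat_aff_indep V"
  obtains T where "lattice_triangulation T (conv A)" "V \<in> T"
proof -
  have "\<exists>T. lattice_triangulation T (conv (V \<union> B)) \<and> V \<in> T" if "finite B" "B \<subseteq> A" for B
    using that
  proof (induction B rule: finite_induct)
    case empty
    have "V \<in> {W. W \<subseteq> V \<and> W \<noteq> {}}" using assms(4) by simp
    moreover have "lattice_triangulation {W. W \<subseteq> V \<and> W \<noteq> {}} (conv (V \<union> {}))"
      using simplex_triangulation[OF assms(5)] assms(2,3) by simp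
    ultimately show ?case by blast
  next
    case (insert p B)
    then obtain T where T: "lattice_triangulation T (conv (V \<union> B))" "V \<in> T" by auto
    show ?case
    proof (cases "p \<in> conv (V \<union> B)")
      case True
      then have "insert p (V \<union> B) \<subseteq> conv (V \<union> B)" by (auto simp: hull_inc)
      then have "conv (insert p (V \<union> B)) = conv (V \<union> B)"
        using conv_subset_conv hull_mono[of "V \<union> B" "insert p (V \<union> B)"] by blast
      then show ?thesis using T by auto
    next
      case False
      have "finite (V \<union> B)" "p \<in> int_vecs" using assms insert finite_subset by auto
      then obtain T' where "T \<subseteq> T'" "lattice_triangulation T' (conv (insert p (V \<union> B)))"
        using extend_triangulation[OF T(1) _ _ False] by blast
      then show ?thesis using T by auto
    qed
  qed
  from this[of A] show ?thesis using that assms by (auto simp: Un_absorb1)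
qed

section \<open>Integrality of barycentric weights\<close>

lemma maximal_aff_indep:
  assumes "finite A" "V \<subseteq> A" "rat_aff_indep V"
  obtains W where "V \<subseteq> W" "W \<subseteq> A" "rat_aff_indep W"
    "\<And>a. a \<in> A \<Longrightarrow> \<exists>c. sum c W = 1 \<and> (\<Sum>v\<in>W. c v *s v) = a"
proof -
  define I where "I = {W. V \<subseteq> W \<and> W \<subseteq> A \<and> rat_aff_indep W}"
  have "finite I" using assms(1) by (simp add: I_def)
  moreover have "V \<in> I" using assms by (simp add: I_def)
  ultimately obtain W where "W \<in> I" and max: "\<And>W'. W' \<in> I \<Longrightarrow> W \<subseteq> W' \<Longrightarrow> W = W'"
    using finite_has_maximal[of I] by blast
  then have W: "V \<subseteq> W" "W \<subseteq> A" "rat_aff_indep W" by (auto simp: I_def)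
  have "\<exists>c. sum c W = 1 \<and> (\<Sum>v\<in>W. c v *s v) = a" if "a \<in> A" for a
  proof (cases "a \<in> W")
    case True
    have "finite W" using W by (simp add: rat_aff_indep_def)
    then show ?thesis using True
      by (intro exI[of _ "\<lambda>v. if v = a then 1 else 0"])
        (simp add: if_distrib[of "\<lambda>c. c *s _"] cong: if_cong)
  next
    case False
    have "insert a W \<notin> I" using max[of "insert a W"] False by blast
    then have "\<not> rat_aff_indep (insert a W)" using W that by (auto simp: I_def)
    then show ?thesis using aff_dependent_insert[OF W(3) False] by blast
  qed
  then show ?thesis using that W by blast
qed

lemma affine_combination_diff:
  fixes b :: "rat ^ 'd"
  assumes "sum c W = 1"
  shows "(\<Sum>v\<in>W. c v *s v) - b = (\<Sum>v\<in>W. c v *s (v - b))"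
proof -
  have "(\<Sum>v\<in>W. c v *s (v - b)) = (\<Sum>v\<in>W. c v *s v) - sum c W *s b"
    by (simp only: vec.scale_right_diff_distrib sum_subtractf vec.scale_sum_left)
  then show ?thesis using assms by simp
qed

text \<open>
  The definition of unimodularity constrains only the simplices of the dimension of \<open>Q\<close>; this
  shows that maximal affinely independent sets of points are among them.
\<close>
lemma rat_aff_dim_affine_basis:
  assumes "finite A" "W \<subseteq> A" "W \<noteq> {}"
    and gen: "\<And>a. a \<in> A \<Longrightarrow> \<exists>c. sum c W = 1 \<and> (\<Sum>v\<in>W. c v *s v) = a"
  shows "rat_aff_dim (conv W) = rat_aff_dim (conv A)"
proof -
  define D where "D S = {x - y | x y. x \<in> S \<and> y \<in> S}" for S :: "(rat ^ 'a) set"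
  obtain b where b: "b \<in> W" using assms by blast
  have "a - b \<in> vec.span (D (conv W))" if "a \<in> A" for a
  proof -
    obtain c where c: "sum c W = 1" "(\<Sum>v\<in>W. c v *s v) = a" using gen \<open>a \<in> A\<close> by blast
    have "v - b \<in> D (conv W)" if "v \<in> W" for v
      using that b hull_inc[of _ W "rat_convex (*s)"] unfolding D_def by blast
    then have "(\<Sum>v\<in>W. c v *s (v - b)) \<in> vec.span (D (conv W))"
      by (intro vec.span_sum vec.span_scale vec.span_base)
    then show ?thesis using affine_combination_diff[OF c(1), of b] c(2) by simp
  qed
  then have A: "x - b \<in> vec.span (D (conv W))" if "x \<in> conv A" for x
  proof -
    obtain w where w: "sum w A = 1" "(\<Sum>v\<in>A. w v *s v) = x"
      using \<open>x \<in> conv A\<close> mem_conv assms(1) unfolding barycentric_def by blast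
    have "(\<Sum>v\<in>A. w v *s (v - b)) \<in> vec.span (D (conv W))"
      using \<open>\<And>a. a \<in> A \<Longrightarrow> a - b \<in> _\<close> by (intro vec.span_sum vec.span_scale)
    then show ?thesis using affine_combination_diff[OF w(1), of b] w(2) by simp
  qed
  have "x - y \<in> vec.span (D (conv W))" if "x \<in> conv A" "y \<in> conv A" for x y
    using vec.span_diff[OF A[OF that(1)] A[OF that(2)]] by simp
  then have "D (conv A) \<subseteq> vec.span (D (conv W))" by (auto simp: D_def)
  moreover have "D (conv W) \<subseteq> D (conv A)" using hull_mono[OF assms(2)] unfolding D_def by blast
  then have "D (conv W) \<subseteq> vec.span (D (conv A))" using vec.span_superset by blast
  ultimately have "vec.span (D (conv W)) = vec.span (D (conv A))"
    by (simp add: vec.span_eq)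
  then show ?thesis unfolding rat_aff_dim_def D_def by (rule vec.span_eq_dim)
qed

text \<open>
  A quotient of the affine lattice with a single class identifies all its points.
\<close>
lemma normalized_volume_one:
  assumes "normalized_volume M W = 1" "x \<in> M" "y \<in> M"
  shows "x - y \<in> edge_lattice W"
proof -
  define R where "R = {(x, y). x \<in> M \<and> y \<in> M \<and> x - y \<in> edge_lattice W}"
  obtain X where X: "M // R = {X}"
    using assms(1) unfolding normalized_volume_def R_def by (auto simp: card_1_singleton_iff)
  have "R `` {x} = R `` {y}" using X assms(2,3) quotientI[of _ M R] by (metis singletonD)
  moreover have "0 \<in> edge_lattice W"
    unfolding edge_lattice_def by (auto intro!: exI[of _ "\<lambda>_. 0"])
  then have "y \<in> R `` {y}" using assms(3) by (simp add: R_def)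
  ultimately show ?thesis by (auto simp: R_def)
qed

text \<open>
  Inside a full-dimensional simplex \<open>W\<close> of a triangulation, \<open>k z\<close> differs from \<open>k v\<close> by an integral
  combination of edges. This yields integral coordinates of \<open>k z\<close> on \<open>W\<close> with sum \<open>k\<close>, and as such
  coordinates are unique, they are \<open>k\<close> times the given weights.
\<close>
lemma unimodular_integral_weights:
  fixes w :: "rat ^ 'd \<Rightarrow> rat"
  assumes unim: "unimodular (conv A)" and A: "finite A" "A \<subseteq> int_vecs"
    and V: "V \<subseteq> A" "rat_aff_indep V" and w: "barycentric w V z"
    and z: "of_nat k *s z \<in> int_vecs" and "v \<in> V"
  shows "of_nat k * w v \<in> \<int>"
proof -
  obtain W where W: "V \<subseteq> W" "W \<subseteq> A" "rat_aff_indep W"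
    and gen: "\<And>a. a \<in> A \<Longrightarrow> \<exists>c. sum c W = 1 \<and> (\<Sum>v\<in>W. c v *s v) = a"
    using maximal_aff_indep[OF A(1) V] by blast
  have Wne: "W \<noteq> {}" and vA: "v \<in> A" "v \<in> W" using \<open>v \<in> V\<close> W by auto
  have finW: "finite W" using W by (simp add: rat_aff_indep_def)
  obtain T where "lattice_triangulation T (conv A)" "W \<in> T"
    using simplex_in_triangulation[OF A W(2) Wne W(3)] by blast
  moreover have "rat_aff_dim (conv W) = rat_aff_dim (conv A)"
    using rat_aff_dim_affine_basis[OF A(1) W(2) Wne gen] .
  ultimately have vol: "normalized_volume ((rat_affine (*s) hull conv A) \<inter> int_vecs) W = 1"
    using unim unfolding unimodular_def by blast
  let ?H = "rat_affine (*s) hull conv A"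
  have aff: "rat_affine (*s) ?H"
    by (rule hull_in) (unfold rat_affine_def, blast)
  have vQ: "v \<in> ?H" using vA by (simp add: hull_inc)
  have "z \<in> conv A"
    using barycentric_imp_conv[OF finite_subset[OF V(1) A(1)] w] hull_mono[OF V(1)] by (rule rev_subsetD)
  then have zQ: "z \<in> ?H" by (simp add: hull_inc)
  \<comment> \<open>The point \<open>k z\<close> itself need not be in the affine span of the polytope; \<open>k z - (k - 1) v\<close> is.\<close>
  define y where "y = of_nat k *s z + (1 - of_nat k) *s v"
  have comb: "a *s z + b *s v \<in> ?H" if "a + b = 1" for a b
    using aff zQ vQ that unfolding rat_affine_def by blast
  have "y \<in> ?H" unfolding y_def by (rule comb) simp
  moreover have "y \<in> int_vecs"
    using z vA A(2) by (auto simp: y_def int_vecs_def)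
  ultimately have "y - v \<in> edge_lattice W"
    using normalized_volume_one[OF vol, of y v] vQ vA A(2) by blast
  then obtain c :: "rat ^ 'd \<Rightarrow> int" where c: "y - v = (\<Sum>u\<in>W. of_int (c u) *s u)" "sum c W = 0"
    unfolding edge_lattice_def by blast
  define w' where "w' u = (if u \<in> V then w u else 0)" for u
  have w': "barycentric w' W z" unfolding w'_def using barycentric_extend[OF finW W(1) w] .
  define e where "e u = of_int (c u) + of_nat k * (if u = v then 1 else (0::rat))" for u
  have "of_nat k * w' v = e v"
  proof (rule rat_aff_indep_weights_unique[OF W(3) _ _ vA(2)])
    have "sum e W = of_int (sum c W) + of_nat k"
      using finW vA by (simp add: e_def sum.distrib flip: sum_distrib_left)
    then show "(\<Sum>u\<in>W. of_nat k * w' u) = sum e W"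
      using w' c(2) by (simp add: barycentric_def flip: sum_distrib_left)
    have "(\<Sum>u\<in>W. e u *s u) = (y - v) + of_nat k *s (\<Sum>u\<in>W. (if u = v then 1 else 0) *s u)"
      unfolding c(1) e_def vec.scale_left_distrib sum.distrib vec.scale_sum_right by simp
    also have "(\<Sum>u\<in>W. (if u = v then 1 else 0) *s u) = v"
      using finW vA by (simp add: if_distrib[of "\<lambda>c. c *s _"] cong: if_cong)
    also have "(y - v) + of_nat k *s v = of_nat k *s z"
      by (simp add: y_def vec_eq_iff algebra_simps)
    also have "\<dots> = (\<Sum>u\<in>W. of_nat k *s (w' u *s u))"
      using w' by (simp only: barycentric_def vec.scale_sum_right[symmetric])
    also have "\<dots> = (\<Sum>u\<in>W. (of_nat k * w' u) *s u)" by (simp only: vec.scale_scale)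
    finally show "(\<Sum>u\<in>W. (of_nat k * w' u) *s u) = (\<Sum>u\<in>W. e u *s u)" by simp
  qed
  then show ?thesis using \<open>v \<in> V\<close> by (simp add: w'_def e_def)
qed

section \<open>Sums of lattice points with prescribed height\<close>

lemma nat_seq_monotone_subsequence:
  fixes s :: "nat \<Rightarrow> nat"
  obtains r :: "nat \<Rightarrow> nat" where "strict_mono r" "\<And>m n. m \<le> n \<Longrightarrow> s (r m) \<le> s (r n)"
proof -
  obtain g where g: "strict_mono g" "monoseq (\<lambda>n. s (g n))"
    using seq_monosub[of s] by blast
  from g(2) consider "\<forall>m n. m \<le> n \<longrightarrow> s (g m) \<le> s (g n)" | "\<forall>m n. m \<le> n \<longrightarrow> s (g n) \<le> s (g m)"
    unfolding monoseq_def by blast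
  then show ?thesis
  proof cases
    case 1
    then show ?thesis using that g by blast
  next
    case 2
    obtain N where N: "\<And>n. s (g N) \<le> s (g n)"
      using ex_has_least_nat[of "\<lambda>_. True" _ "\<lambda>n. s (g n)"] by blast
    have "strict_mono (\<lambda>n. g (N + n))"
      using g(1) by (simp add: strict_mono_def)
    moreover have "s (g (N + m)) \<le> s (g (N + n))" for m n
      using 2 N[of "N + n"] by (meson le_add1 order_trans)
    ultimately show ?thesis using that by blast
  qed
qed

lemma mset_seq_monotone_subsequence:
  assumes "finite A" "\<And>n. set_mset (f n) \<subseteq> A"
  shows "\<exists>r :: nat \<Rightarrow> nat. strict_mono r \<and> (\<forall>m n. m \<le> n \<longrightarrow> f (r m) \<subseteq># f (r n))"
  using assms
proof (induction A arbitrary: f rule: finite_induct)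
  case empty
  then show ?case by (intro exI[of _ id]) (auto simp: strict_mono_def)
next
  case (insert a A)
  define f' where "f' n = filter_mset (\<lambda>x. x \<noteq> a) (f n)" for n
  have "set_mset (f' n) \<subseteq> A" for n using insert.prems[of n] by (auto simp: f'_def)
  then obtain r :: "nat \<Rightarrow> nat" where r: "strict_mono r" "\<forall>m n. m \<le> n \<longrightarrow> f' (r m) \<subseteq># f' (r n)"
    using insert.IH[of f'] by blast
  obtain q :: "nat \<Rightarrow> nat" where q: "strict_mono q" "\<And>m n. m \<le> n \<Longrightarrow> count (f (r (q m))) a \<le> count (f (r (q n))) a"
    using nat_seq_monotone_subsequence[of "\<lambda>n. count (f (r n)) a"] by blast
  have "f (r (q m)) \<subseteq># f (r (q n))" if "m \<le> n" for m n
  proof (rule mset_subset_eqI)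
    fix x
    have "q m \<le> q n" using q(1) that by (simp add: strict_mono_less_eq)
    then have "count (f' (r (q m))) x \<le> count (f' (r (q n))) x"
      by (intro mset_subset_eq_count r(2)[rule_format])
    then show "count (f (r (q m))) x \<le> count (f (r (q n))) x"
      using q(2)[OF that] by (cases "x = a") (auto simp: f'_def)
  qed
  moreover have "strict_mono (\<lambda>n. r (q n))"
    using r(1) q(1) by (simp add: strict_mono_def)
  ultimately show ?case by blast
qed

text \<open>
  Dickson's lemma. The minimal pairs form an antichain, and an infinite antichain is excluded by
  passing to a subsequence that increases in the first and then to one that also increases in the
  second component.
\<close>
lemma finitely_many_minimal_mset_pairs:
  assumes A: "finite A" and X: "\<And>M N. (M, N) \<in> X \<Longrightarrow> set_mset M \<subseteq> A \<and> set_mset N \<subseteq> A"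
  obtains B where "finite B" "B \<subseteq> X"
    "\<And>M N. (M, N) \<in> X \<Longrightarrow> \<exists>(M', N') \<in> B. M' \<subseteq># M \<and> N' \<subseteq># N"
proof -
  define below where "below p q \<longleftrightarrow> fst p \<subseteq># fst q \<and> snd p \<subseteq># snd q" for p q :: "'a multiset \<times> 'a multiset"
  define B where "B = {p \<in> X. \<forall>q\<in>X. below q p \<longrightarrow> q = p}"
  have "finite B"
  proof (rule ccontr)
    assume "infinite B"
    then obtain f :: "nat \<Rightarrow> _" where f: "inj f" "range f \<subseteq> B"
      using infinite_countable_subset by blast
    have supp: "set_mset (fst (f n)) \<subseteq> A" "set_mset (snd (f n)) \<subseteq> A" for n
      using X[of "fst (f n)" "snd (f n)"] f(2) by (auto simp: B_def)
    obtain r :: "nat \<Rightarrow> nat" where r: "strict_mono r" "\<And>m n. m \<le> n \<Longrightarrow> fst (f (r m)) \<subseteq># fst (f (r n))"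
      using mset_seq_monotone_subsequence[OF A, of "\<lambda>n. fst (f n)"] supp by blast
    obtain q :: "nat \<Rightarrow> nat" where q: "strict_mono q" "\<And>m n. m \<le> n \<Longrightarrow> snd (f (r (q m))) \<subseteq># snd (f (r (q n)))"
      using mset_seq_monotone_subsequence[OF A, of "\<lambda>n. snd (f (r n))"] supp by blast
    have lt: "q 0 < q 1" using q(1) by (simp add: strict_mono_def)
    then have "below (f (r (q 0))) (f (r (q 1)))"
      using r(2)[of "q 0" "q 1"] q(2)[of 0 1] by (simp add: below_def)
    then have "f (r (q 0)) = f (r (q 1))" using f(2) unfolding B_def by blast
    then have "r (q 0) = r (q 1)" using f(1) by (simp add: inj_eq)
    then show False using r(1) lt by (simp add: strict_mono_eq)
  qed
  have dominated: "\<exists>q\<in>B. below q p" if "p \<in> X" for p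
    using that
  proof (induction "size (fst p) + size (snd p)" arbitrary: p rule: less_induct)
    case less
    show ?case
    proof (cases "p \<in> B")
      case True
      then show ?thesis by (auto simp: below_def)
    next
      case False
      then obtain q where q: "q \<in> X" "below q p" "q \<noteq> p" using less.prems by (auto simp: B_def)
      have "size (fst q) + size (snd q) < size (fst p) + size (snd p)"
      proof (cases "fst q = fst p")
        case True
        then have "snd q \<subset># snd p" using q by (auto simp: below_def subset_mset_def prod_eq_iff)
        then show ?thesis using True mset_subset_size by fastforce
      next
        case False
        then have "fst q \<subset># fst p" using q by (auto simp: below_def subset_mset_def)
        then show ?thesis using mset_subset_size size_mset_mono[of "snd q" "snd p"] q(2)
          by (fastforce simp: below_def)
      qed
      then obtain b where b: "b \<in> B" "below b q" using less.hyps q(1) by blast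
      then have "below b p" using q(2) unfolding below_def by (meson subset_mset.order_trans)
      then show ?thesis using b by blast
    qed
  qed
  show ?thesis
  proof (rule that)
    show "finite B" by fact
    show "B \<subseteq> X" by (auto simp: B_def)
    show "\<exists>(M', N') \<in> B. M' \<subseteq># M \<and> N' \<subseteq># N" if "(M, N) \<in> X" for M N
      using dominated[OF that] by (auto simp: below_def split: prod.splits)
  qed
qed

lemma sum_mset_add_size_le:
  fixes lo hi :: "'a \<Rightarrow> int"
  assumes "\<And>a. a \<in># M \<Longrightarrow> lo a < hi a"
  shows "(\<Sum>a\<in>#M. lo a) + int (size M) \<le> (\<Sum>a\<in>#M. hi a)"
  using assms by (induction M) force+

text \<open>
  \<open>C\<close> bounds the rise of the lower end of the interval \<open>[lo, hi]\<close> under the finitely many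
  generating exchanges. The exchanges needed to turn \<open>M\<close> into \<open>N\<close> are carried out one at a time
  as long as the lower end stays at or below \<open>t\<close>. If the next one lifts it beyond \<open>t\<close>, then \<open>t\<close> is
  within \<open>C\<close> of the lower end of the current interval, whose length is at least its size.
\<close>
lemma intermediate_representation:
  fixes lo hi :: "'v::cancel_comm_monoid_add \<Rightarrow> int"
  assumes A: "finite A" and lohi: "\<And>a. a \<in> A \<Longrightarrow> lo a < hi a"
  obtains C where
    "\<And>M N t. \<lbrakk>set_mset M \<subseteq> A; set_mset N \<subseteq> A; size M = size N; \<Sum>\<^sub># M = \<Sum>\<^sub># N; C \<le> size M;
       (\<Sum>a\<in>#M. lo a) \<le> t; t \<le> (\<Sum>a\<in>#N. hi a)\<rbrakk> \<Longrightarrow>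
     \<exists>L. set_mset L \<subseteq> A \<and> size L = size M \<and> \<Sum>\<^sub># L = \<Sum>\<^sub># M \<and> (\<Sum>a\<in>#L. lo a) \<le> t \<and> t \<le> (\<Sum>a\<in>#L. hi a)"
proof -
  define X where "X = {(M, N). set_mset M \<subseteq> A \<and> set_mset N \<subseteq> A \<and> size M = size N
      \<and> \<Sum>\<^sub># M = \<Sum>\<^sub># N \<and> M \<noteq> {#}}"
  obtain B where B: "finite B" "B \<subseteq> X"
    and gen: "\<And>M N. (M, N) \<in> X \<Longrightarrow> \<exists>(M', N') \<in> B. M' \<subseteq># M \<and> N' \<subseteq># N"
    by (rule finitely_many_minimal_mset_pairs[OF A, of X]) (auto simp: X_def)
  define D where "D = (\<lambda>(M, N). (\<Sum>a\<in>#N. lo a) - (\<Sum>a\<in>#M. lo a))"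
  define C where "C = nat (Max (insert 0 (D ` B)))"
  have D_le: "D b \<le> int C" if "b \<in> B" for b
    using that B(1) by (auto simp: C_def Max_ge_iff)
  have step: "\<exists>L. set_mset L \<subseteq> A \<and> size L = size (M + K) \<and> \<Sum>\<^sub># L = \<Sum>\<^sub># (M + K)
      \<and> (\<Sum>a\<in>#L. lo a) \<le> t \<and> t \<le> (\<Sum>a\<in>#L. hi a)"
    if "set_mset M \<subseteq> A" "set_mset N \<subseteq> A" "set_mset K \<subseteq> A" "size M = size N" "\<Sum>\<^sub># M = \<Sum>\<^sub># N"
      "C \<le> size (M + K)" "(\<Sum>a\<in>#M + K. lo a) \<le> t" "t \<le> (\<Sum>a\<in>#N + K. hi a)" for M N K t
    using that
  proof (induction "size M" arbitrary: M N K rule: less_induct)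
    case less
    show ?case
    proof (cases "M = {#}")
      case True
      then show ?thesis using less.prems by (intro exI[of _ K]) auto
    next
      case False
      then have "(M, N) \<in> X" using less.prems by (simp add: X_def)
      then obtain G H where GH: "(G, H) \<in> B" "G \<subseteq># M" "H \<subseteq># N" using gen by blast
      then have GHX: "set_mset G \<subseteq> A" "set_mset H \<subseteq> A" "size G = size H" "\<Sum>\<^sub># G = \<Sum>\<^sub># H" "G \<noteq> {#}"
        using B(2) by (auto simp: X_def)
      obtain M1 N1 where M1: "M = G + M1" and N1: "N = H + N1"
        using GH by (meson mset_subset_eq_exists_conv)
      show ?thesis
      proof (cases "(\<Sum>a\<in>#M1 + (H + K). lo a) \<le> t")
        case True
        have "size M1 < size M" using M1 GHX(5) by (simp add: nonempty_has_size)
        moreover have "set_mset M1 \<subseteq> A" "set_mset N1 \<subseteq> A" "set_mset (H + K) \<subseteq> A"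
            "size M1 = size N1"
          using less.prems GHX M1 N1 by auto
        moreover have "\<Sum>\<^sub># M1 = \<Sum>\<^sub># N1" using less.prems GHX M1 N1 by simp
        moreover have "C \<le> size (M1 + (H + K))" using less.prems GHX M1 by simp
        moreover have "t \<le> (\<Sum>a\<in>#N1 + (H + K). hi a)" using less.prems N1 by (simp add: ac_simps)
        ultimately obtain L where L: "set_mset L \<subseteq> A" "size L = size (M1 + (H + K))"
            "\<Sum>\<^sub># L = \<Sum>\<^sub># (M1 + (H + K))" "(\<Sum>a\<in>#L. lo a) \<le> t" "t \<le> (\<Sum>a\<in>#L. hi a)"
          using less.hyps[of M1 N1 "H + K"] True by blast
        have "size L = size (M + K)" "\<Sum>\<^sub># L = \<Sum>\<^sub># (M + K)"
          using L(2,3) GHX M1 by (simp_all add: ac_simps)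
        then show ?thesis using L by blast
      next
        case False
        have "t < (\<Sum>a\<in>#M + K. lo a) + D (G, H)" using False M1 by (simp add: D_def)
        also have "\<dots> \<le> (\<Sum>a\<in>#M + K. lo a) + int (size (M + K))"
          using D_le[OF GH(1)] less.prems(6) by simp
        also have "\<dots> \<le> (\<Sum>a\<in>#M + K. hi a)"
          using less.prems by (intro sum_mset_add_size_le lohi) auto
        finally have "t \<le> (\<Sum>a\<in>#M + K. hi a)" by simp
        then show ?thesis using less.prems by (intro exI[of _ "M + K"]) auto
      qed
    qed
  qed
  show ?thesis
  proof (rule that)
    fix M N t
    assume "set_mset M \<subseteq> A" "set_mset N \<subseteq> A" "size M = size N" "\<Sum>\<^sub># M = \<Sum>\<^sub># N" "C \<le> size M"
       "(\<Sum>a\<in>#M. lo a) \<le> t" "t \<le> (\<Sum>a\<in>#N. hi a)"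
    then show "\<exists>L. set_mset L \<subseteq> A \<and> size L = size M \<and> \<Sum>\<^sub># L = \<Sum>\<^sub># M \<and> (\<Sum>a\<in>#L. lo a) \<le> t \<and> t \<le> (\<Sum>a\<in>#L. hi a)"
      using step[of M N "{#}" t] by simp
  qed
qed

section \<open>Polytopes fibered over a lattice polytope\<close>

text \<open>
  Sums of integers taken from integral intervals fill the interval between the sums of the end
  points; here the intervals are the fibers over the members of \<open>M\<close>.
\<close>
lemma lift_mset_to_fibers:
  fixes lo hi :: "rat ^ 'd \<Rightarrow> int"
  assumes "\<And>a. a \<in># M \<Longrightarrow> lo a \<le> hi a"
    and "\<And>a s. a \<in># M \<Longrightarrow> lo a \<le> s \<Longrightarrow> s \<le> hi a \<Longrightarrow> (of_int s, a) \<in> R"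
    and "(\<Sum>a\<in>#M. lo a) \<le> t" "t \<le> (\<Sum>a\<in>#M. hi a)"
  shows "\<exists>p. (\<forall>i<size M. p i \<in> R) \<and> (of_int t, \<Sum>\<^sub># M) = (\<Sum>i<size M. p i)"
  using assms
proof (induction M arbitrary: t)
  case empty
  then show ?case by (simp add: zero_prod_def)
next
  case (add a M)
  define s where "s = max (lo a) (t - (\<Sum>a\<in>#M. hi a))"
  have "(\<Sum>a\<in>#M. lo a) \<le> (\<Sum>a\<in>#M. hi a)" using add.prems(1) by (intro sum_mset_mono) auto
  then have s: "lo a \<le> s" "s \<le> hi a" "(\<Sum>a\<in>#M. lo a) \<le> t - s" "t - s \<le> (\<Sum>a\<in>#M. hi a)"
    using add.prems(1)[of a] add.prems(3,4) by (auto simp: s_def)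
  obtain p where p: "\<forall>i<size M. p i \<in> R" "(of_int (t - s), \<Sum>\<^sub># M) = (\<Sum>i<size M. p i)"
    using add.IH[of "t - s"] add.prems s by auto
  define p' where "p' = p(size M := (of_int s, a))"
  have "(\<Sum>i<size M. p' i) = (\<Sum>i<size M. p i)" by (intro sum.cong) (auto simp: p'_def)
  then have "(of_int t, \<Sum>\<^sub># (add_mset a M)) = (\<Sum>i<size (add_mset a M). p' i)"
    using p(2)[symmetric] by (simp add: p'_def add.commute)
  moreover have "\<forall>i<size (add_mset a M). p' i \<in> R"
    using p(1) add.prems(2)[of a s] s by (auto simp: p'_def less_Suc_eq)
  ultimately show ?case by blast
qed

text \<open>
  Weights that become integral after multiplication with \<open>k\<close> are the multiplicities of a multiset
  of \<open>k\<close> points, and \<open>k\<close> times the cost becomes its sum of values.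
\<close>
lemma integral_weights_mset:
  fixes w :: "rat ^ 'd \<Rightarrow> rat" and g :: "rat ^ 'd \<Rightarrow> int"
  assumes "finite V" "barycentric w V z" "\<And>v. v \<in> V \<Longrightarrow> of_nat k * w v \<in> \<int>"
  obtains M where "set_mset M \<subseteq> V" "size M = k" "\<Sum>\<^sub># M = of_nat k *s z"
    "of_int (\<Sum>a\<in>#M. g a) = of_nat k * (\<Sum>v\<in>V. w v * of_int (g v))"
proof -
  have "\<exists>n. of_nat n = of_nat k * w v" if "v \<in> V" for v
  proof -
    have "0 \<le> of_nat k * w v" using assms(2) that by (simp add: barycentric_def)
    then show ?thesis using assms(3)[OF that] by (metis Nats_cases Nats_altdef2 mem_Collect_eq)
  qed
  then obtain n where n: "\<And>v. v \<in> V \<Longrightarrow> of_nat (n v) = of_nat k * w v" by metis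
  define M where "M = (\<Sum>v\<in>V. replicate_mset (n v) v)"
  have rep: "of_nat m * v = of_nat m *s v" for m and v :: "rat ^ 'd"
    by (induction m) (auto simp: vec.scale_left_distrib distrib_right)
  have M: "set_mset M \<subseteq> V" "size M = sum n V" "\<Sum>\<^sub># M = (\<Sum>v\<in>V. of_nat (n v) *s v)"
    "(\<Sum>a\<in>#M. g a) = (\<Sum>v\<in>V. int (n v) * g v)"
    unfolding M_def using assms(1) by (induction V rule: finite_induct) (auto simp: rep)
  have "(of_nat (size M) :: rat) = of_nat k"
    using assms(2) n by (simp add: M(2) barycentric_def flip: sum_distrib_left)
  then have "size M = k" by (simp only: of_nat_eq_iff)
  moreover have "\<Sum>\<^sub># M = of_nat k *s z"
  proof -
    have "\<Sum>\<^sub># M = (\<Sum>v\<in>V. of_nat k *s (w v *s v))"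
      unfolding M(3) using n by (intro sum.cong) auto
    then show ?thesis using assms(2) by (simp only: barycentric_def vec.scale_sum_right[symmetric])
  qed
  moreover have "of_int (\<Sum>a\<in>#M. g a) = of_nat k * (\<Sum>v\<in>V. w v * of_int (g v))"
    unfolding M(4) using n by (simp add: sum_distrib_left mult.assoc)
  ultimately show ?thesis using that M(1) by blast
qed

lemma snd_hull:
  "snd ` (rat_convex pscale hull S) = conv (snd ` S)"
proof
  have "rat_convex pscale {q. snd q \<in> conv (snd ` S)}"
    using rat_convex_hull[of "(*s)" "snd ` S"] unfolding rat_convex_def by (simp add: pscale_def)
  then have "rat_convex pscale hull S \<subseteq> {q. snd q \<in> conv (snd ` S)}"
    using hull_subset[of "snd ` S" "rat_convex (*s)"] by (intro hull_minimal) blast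
  then show "snd ` (rat_convex pscale hull S) \<subseteq> conv (snd ` S)" by blast
  show "conv (snd ` S) \<subseteq> snd ` (rat_convex pscale hull S)"
  proof (rule hull_minimal)
    show "snd ` S \<subseteq> snd ` (rat_convex pscale hull S)" by (intro image_mono hull_subset)
    show "rat_convex (*s) (snd ` (rat_convex pscale hull S))"
      unfolding rat_convex_def[of _ "snd ` _"]
    proof (intro ballI allI impI)
      fix x y :: "rat ^ 'a" and u v :: rat
      assume "x \<in> snd ` (rat_convex pscale hull S)" "y \<in> snd ` (rat_convex pscale hull S)"
        and uv: "0 \<le> u" "0 \<le> v" "u + v = 1"
      then obtain q q' where q: "q \<in> rat_convex pscale hull S" "q' \<in> rat_convex pscale hull S"
          "x = snd q" "y = snd q'" by blast
      have "pscale u q + pscale v q' \<in> rat_convex pscale hull S"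
        using rat_convex_hull[of pscale S] q uv unfolding rat_convex_def[of _ "_ hull _"] by blast
      moreover have "snd (pscale u q + pscale v q') = u *s x + v *s y"
        using q by (simp add: pscale_def)
      ultimately show "u *s x + v *s y \<in> snd ` (rat_convex pscale hull S)" by (metis imageI)
    qed
  qed
qed

text \<open>
  The pairs of a height and a base point for which \<open>e\<close> times the height bounds some weighted mean of
  the values \<open>g\<close> at that base point form a convex set containing the spanning points. The sign \<open>e\<close> covers lower bounds \<open>g = lo\<close> with \<open>e = 1\<close> and upper
  bounds \<open>g = - hi\<close> with \<open>e = - 1\<close> at once.
\<close>
lemma weights_below_height:
  fixes S :: "(rat \<times> (rat ^ 'd)) set"
  assumes "finite S" "\<And>s. s \<in> S \<Longrightarrow> g (snd s) \<le> e * fst s" "q \<in> rat_convex pscale hull S"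
  shows "\<exists>w. barycentric w (snd ` S) (snd q) \<and> (\<Sum>a\<in>snd ` S. w a * g a) \<le> e * fst q"
proof -
  let ?C = "{q. \<exists>w. barycentric w (snd ` S) (snd q) \<and> (\<Sum>a\<in>snd ` S. w a * g a) \<le> e * fst q}"
  have "rat_convex pscale hull S \<subseteq> ?C"
  proof (rule hull_minimal)
    show "S \<subseteq> ?C"
    proof
      fix s assume s: "s \<in> S"
      define w where "w a = (if a = snd s then 1 else (0::rat))" for a
      have "barycentric w (snd ` S) (snd s)" "(\<Sum>a\<in>snd ` S. w a * g a) = g (snd s)"
        using assms(1) s
        by (auto simp: w_def barycentric_def if_distrib[of "\<lambda>c. c *s _"] if_distrib[of "\<lambda>c. c * _"] cong: if_cong)
      then show "s \<in> ?C" using assms(2)[OF s] by auto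
    qed
    show "rat_convex pscale ?C"
      unfolding rat_convex_def
    proof (intro ballI allI impI)
      fix x y :: "rat \<times> (rat ^ 'd)" and u v :: rat
      assume "x \<in> ?C" "y \<in> ?C" and uv: "0 \<le> u" "0 \<le> v" "u + v = 1"
      then obtain w w' where w: "barycentric w (snd ` S) (snd x)" "(\<Sum>a\<in>snd ` S. w a * g a) \<le> e * fst x"
        and w': "barycentric w' (snd ` S) (snd y)" "(\<Sum>a\<in>snd ` S. w' a * g a) \<le> e * fst y" by blast
      define W where "W a = u * w a + v * w' a" for a
      have "sum W (snd ` S) = 1"
        using w(1) w'(1) uv by (simp add: W_def barycentric_def sum.distrib flip: sum_distrib_left)
      moreover have "(\<Sum>a\<in>snd ` S. W a *s a) = u *s (\<Sum>a\<in>snd ` S. w a *s a) + v *s (\<Sum>a\<in>snd ` S. w' a *s a)"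
        by (simp add: W_def sum.distrib vec.scale_left_distrib vec.scale_sum_right)
      ultimately have "barycentric W (snd ` S) (snd (pscale u x + pscale v y))"
        using w(1) w'(1) uv by (simp add: W_def barycentric_def pscale_def)
      moreover have "(\<Sum>a\<in>snd ` S. W a * g a) \<le> e * fst (pscale u x + pscale v y)"
      proof -
        have "(\<Sum>a\<in>snd ` S. W a * g a) = u * (\<Sum>a\<in>snd ` S. w a * g a) + v * (\<Sum>a\<in>snd ` S. w' a * g a)"
          by (simp add: W_def sum.distrib distrib_right sum_distrib_left mult.assoc)
        also have "\<dots> \<le> u * (e * fst x) + v * (e * fst y)"
          using w(2) w'(2) uv by (intro add_mono mult_left_mono) auto
        finally show ?thesis by (simp add: pscale_def algebra_simps)
      qed
      ultimately show "pscale u x + pscale v y \<in> ?C" by blast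
    qed
  qed
  then show ?thesis using assms(3) by blast
qed

lemma lattice_segment_fiber:
  fixes P :: "(rat \<times> (rat ^ 'd)) set"
  assumes "lattice_segment pscale prod_lattice (snd -` {a} \<inter> P)"
  obtains lo hi :: int where "lo < hi" "\<And>r. (r, a) \<in> P \<Longrightarrow> of_int lo \<le> r \<and> r \<le> of_int hi"
    "\<And>s. lo \<le> s \<Longrightarrow> s \<le> hi \<Longrightarrow> (of_int s, a) \<in> P"
proof -
  obtain b c where bc: "b \<in> prod_lattice" "c \<in> prod_lattice" "b \<noteq> c"
    and seg: "snd -` {a} \<inter> P = rat_convex pscale hull {b, c}"
    using assms unfolding lattice_segment_def by blast
  obtain b' c' where b'c': "{b, c} = {b', c'}" "fst b' \<le> fst c'"
    by (metis insert_commute linear)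
  have seg': "snd -` {a} \<inter> P = rat_convex pscale hull {b', c'}" using seg b'c'(1) by (simp only:)
  have mem: "b' \<in> snd -` {a} \<inter> P" "c' \<in> snd -` {a} \<inter> P"
    unfolding seg' by (simp_all add: hull_inc)
  have "b' \<in> prod_lattice" "c' \<in> prod_lattice" "b' \<noteq> c'" using bc b'c'(1) by (auto simp: doubleton_eq_iff)
  then obtain lo hi :: int where lohi: "b' = (of_int lo, a)" "c' = (of_int hi, a)"
    using mem by (auto simp: prod_lattice_def elim!: Ints_cases)
  have lt: "lo < hi" using \<open>b' \<noteq> c'\<close> b'c'(2) lohi by simp
  show ?thesis
  proof (rule that[OF lt])
    fix r assume "(r, a) \<in> P"
    then have "(r, a) \<in> snd -` {a} \<inter> P" by simp
    then have "(r, a) \<in> rat_convex pscale hull {b', c'}" by (simp only: seg')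
    moreover have "rat_convex pscale hull {b', c'} \<subseteq> {q. of_int lo \<le> fst q \<and> fst q \<le> of_int hi}"
    proof (rule hull_minimal)
      show "{b', c'} \<subseteq> {q. of_int lo \<le> fst q \<and> fst q \<le> of_int hi}" using lohi lt by simp
      show "rat_convex pscale {q :: rat \<times> (rat ^ 'd). of_int lo \<le> fst q \<and> fst q \<le> of_int hi}"
        unfolding rat_convex_def
      proof (intro ballI allI impI)
        fix x y :: "rat \<times> (rat ^ 'd)" and u v :: rat
        assume "x \<in> {q. of_int lo \<le> fst q \<and> fst q \<le> of_int hi}"
          "y \<in> {q. of_int lo \<le> fst q \<and> fst q \<le> of_int hi}" "0 \<le> u" "0 \<le> v" "u + v = 1"
        then show "pscale u x + pscale v y \<in> {q. of_int lo \<le> fst q \<and> fst q \<le> of_int hi}"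
          using convex_bound_le[of "fst x" "of_int hi" "fst y" u v]
            convex_bound_le[of "- fst x" "- of_int lo" "- fst y" u v]
          by (simp add: pscale_def)
      qed
    qed
    ultimately show "of_int lo \<le> r \<and> r \<le> of_int hi" by auto
  next
    fix s assume s: "lo \<le> s" "s \<le> hi"
    define u where "u = (of_int (hi - s) / of_int (hi - lo) :: rat)"
    have u: "0 \<le> u" "0 \<le> 1 - u" using s lt by (auto simp: u_def divide_simps)
    have "pscale u b' + pscale (1 - u) c' \<in> rat_convex pscale hull {b', c'}"
    proof -
      have "rat_convex pscale (rat_convex pscale hull {b', c'})" by (rule rat_convex_hull)
      then have "\<forall>u\<ge>0. \<forall>v\<ge>0. u + v = 1 \<longrightarrow> pscale u b' + pscale v c' \<in> rat_convex pscale hull {b', c'}"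
        using hull_inc[of b' "{b', c'}" "rat_convex pscale"] hull_inc[of c' "{b', c'}" "rat_convex pscale"]
        unfolding rat_convex_def[of pscale "_ hull _"] by blast
      then show ?thesis using u by simp
    qed
    moreover have "pscale u b' + pscale (1 - u) c' = (of_int s, a)"
    proof -
      have "u * of_int (hi - lo) = of_int (hi - s)" using lt by (simp add: u_def)
      then have "u * of_int lo + (1 - u) * of_int hi = of_int s" by (simp add: algebra_simps)
      then show ?thesis by (simp add: lohi pscale_def)
    qed
    ultimately have "(of_int s, a) \<in> snd -` {a} \<inter> P" by (simp only: seg')
    then show "(of_int s, a) \<in> P" by simp
  qed
qed

theorem theorem3:
  fixes P :: "(rat \<times> (rat ^ 'd)) set"
  assumes "lattice_polytope pscale prod_lattice P"
    and "lattice_segmental_fibration snd P"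
    and "unimodular (snd ` P)"
  shows "very_ample pscale prod_lattice P"
proof -
  obtain S where S: "finite S" "S \<subseteq> prod_lattice" "P = rat_convex pscale hull S"
    using assms(1) unfolding lattice_polytope_def by blast
  define A where "A = snd ` S"
  have A: "finite A" "A \<subseteq> int_vecs" using S(1,2) by (auto simp: A_def prod_lattice_def)
  have Q: "snd ` P = conv A" by (simp add: S(3) A_def snd_hull)
  then have unim: "unimodular (conv A)" using assms(3) by simp
  have "\<exists>lo hi :: int. lo < hi \<and> (\<forall>r. (r, a) \<in> P \<longrightarrow> of_int lo \<le> r \<and> r \<le> of_int hi) \<and>
      (\<forall>s. lo \<le> s \<longrightarrow> s \<le> hi \<longrightarrow> (of_int s, a) \<in> P)" if "a \<in> A" for a
  proof -
    have "a \<in> snd ` P \<inter> int_vecs" using that A(2) Q by (auto simp: hull_inc)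
    then have "lattice_segment pscale prod_lattice (snd -` {a} \<inter> P)"
      using assms(2) unfolding lattice_segmental_fibration_def by blast
    from lattice_segment_fiber[OF this] show ?thesis by metis
  qed
  then obtain lo hi :: "rat ^ 'd \<Rightarrow> int" where lohi: "\<And>a. a \<in> A \<Longrightarrow> lo a < hi a"
    and bounds: "\<And>a r. a \<in> A \<Longrightarrow> (r, a) \<in> P \<Longrightarrow> of_int (lo a) \<le> r \<and> r \<le> of_int (hi a)"
    and fiber: "\<And>a s. a \<in> A \<Longrightarrow> lo a \<le> s \<Longrightarrow> s \<le> hi a \<Longrightarrow> (of_int s, a) \<in> P"
    by metis
  have SP: "snd s \<in> A" "of_int (lo (snd s)) \<le> fst s" "fst s \<le> of_int (hi (snd s))" if "s \<in> S" for s
    using that bounds[of "snd s" "fst s"] by (auto simp: A_def S(3) hull_inc)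
  have represent: "\<exists>M. set_mset M \<subseteq> A \<and> size M = k \<and> \<Sum>\<^sub># M = of_nat k *s snd q
      \<and> of_int (\<Sum>a\<in>#M. g a) \<le> of_nat k * (e * fst q)"
    if q: "q \<in> P" "of_nat k *s snd q \<in> int_vecs"
      and g: "\<And>s. s \<in> S \<Longrightarrow> of_int (g (snd s)) \<le> e * fst s" for k q e and g :: "rat ^ 'd \<Rightarrow> int"
  proof -
    obtain w where w: "barycentric w A (snd q)" "(\<Sum>a\<in>A. w a * of_int (g a)) \<le> e * fst q"
      using weights_below_height[of S "\<lambda>a. of_int (g a)" e q] S(1,3) q(1) g unfolding A_def by blast
    obtain V w' where V: "V \<subseteq> A" "rat_aff_indep V" "barycentric w' V (snd q)"
        "(\<Sum>v\<in>V. w' v * of_int (g v)) \<le> (\<Sum>a\<in>A. w a * of_int (g a))"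
      using caratheodory_with_cost[OF A(1) w(1), of "\<lambda>a. of_int (g a)"] by blast
    have "finite V" using V(2) by (simp add: rat_aff_indep_def)
    then obtain M where M: "set_mset M \<subseteq> V" "size M = k" "\<Sum>\<^sub># M = of_nat k *s snd q"
        "of_int (\<Sum>a\<in>#M. g a) = of_nat k * (\<Sum>v\<in>V. w' v * of_int (g v))"
      using integral_weights_mset[OF _ V(3), of k g]
        unimodular_integral_weights[OF unim A V(1,2,3) q(2)] by blast
    have "of_int (\<Sum>a\<in>#M. g a) \<le> of_nat k * (e * fst q)"
      unfolding M(4) using w(2) V(4) by (intro mult_left_mono) auto
    then show ?thesis using M V(1) by blast
  qed
  obtain C where C: "\<And>M N t. \<lbrakk>set_mset M \<subseteq> A; set_mset N \<subseteq> A; size M = size N; \<Sum>\<^sub># M = \<Sum>\<^sub># N; C \<le> size M;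
       (\<Sum>a\<in>#M. lo a) \<le> t; t \<le> (\<Sum>a\<in>#N. hi a)\<rbrakk> \<Longrightarrow>
     \<exists>L. set_mset L \<subseteq> A \<and> size L = size M \<and> \<Sum>\<^sub># L = \<Sum>\<^sub># M \<and> (\<Sum>a\<in>#L. lo a) \<le> t \<and> t \<le> (\<Sum>a\<in>#L. hi a)"
    using intermediate_representation[OF A(1), of lo hi] lohi by blast
  show ?thesis
    unfolding very_ample_def eventually_sequentially
  proof (intro exI[of _ C] allI impI ballI)
    fix k x assume k: "C \<le> k" and x: "x \<in> pscale (of_nat k) ` P \<inter> prod_lattice"
    then obtain q where q: "q \<in> P" "x = (of_nat k * fst q, of_nat k *s snd q)"
      by (auto simp: pscale_def)
    have int: "of_nat k *s snd q \<in> int_vecs" and "of_nat k * fst q \<in> \<int>"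
      using x q(2) by (auto simp: prod_lattice_def)
    then obtain t where t: "of_nat k * fst q = of_int t" by (auto elim: Ints_cases)
    obtain M where M: "set_mset M \<subseteq> A" "size M = k" "\<Sum>\<^sub># M = of_nat k *s snd q"
        "of_int (\<Sum>a\<in>#M. lo a) \<le> of_nat k * (1 * fst q)"
      using represent[OF q(1) int, of lo 1] SP by auto
    obtain N where N: "set_mset N \<subseteq> A" "size N = k" "\<Sum>\<^sub># N = of_nat k *s snd q"
        "of_int (\<Sum>a\<in>#N. - hi a) \<le> of_nat k * (- 1 * fst q)"
      using represent[OF q(1) int, of "\<lambda>a. - hi a" "- 1"] SP by auto
    have "(\<Sum>a\<in>#M. lo a) \<le> t" using M(4) t by simp
    moreover have "t \<le> (\<Sum>a\<in>#N. hi a)"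
    proof -
      have "(\<Sum>a\<in>#N. - hi a) = - (\<Sum>a\<in>#N. hi a)" by (induction N) auto
      moreover have "of_int (\<Sum>a\<in>#N. - hi a) \<le> (of_int (- t) :: rat)" using N(4) t by simp
      ultimately show ?thesis by (simp only: of_int_le_iff)
    qed
    ultimately obtain L where L: "set_mset L \<subseteq> A" "size L = k" "\<Sum>\<^sub># L = of_nat k *s snd q"
        "(\<Sum>a\<in>#L. lo a) \<le> t" "t \<le> (\<Sum>a\<in>#L. hi a)"
      using C[OF M(1) N(1), of t] M(2,3) N(2,3) k by auto
    have "\<exists>p. (\<forall>i<size L. p i \<in> P \<inter> prod_lattice) \<and> (of_int t, \<Sum>\<^sub># L) = (\<Sum>i<size L. p i)"
    proof (rule lift_mset_to_fibers[OF _ _ L(4,5)])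
      fix a s assume a: "a \<in># L" and s: "lo a \<le> s" "s \<le> hi a"
      then show "(of_int s, a) \<in> P \<inter> prod_lattice"
        using fiber L(1) A(2) by (auto simp: prod_lattice_def)
    qed (use lohi L(1) in force)
    then show "\<exists>p. (\<forall>i<k. p i \<in> P \<inter> prod_lattice) \<and> x = (\<Sum>i<k. p i)"
      using L(2,3) q(2) t by simp
  qed
qed

end
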